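(* Let $(M,X)$ be a dynamical system with $d:=\dim M$. Let $\Lambda$ be an $l$-dimensional manifold, with $l\leq d$, and $F:M\rightarrow\Lambda$ a fibration such that $\operatorname{Im}X\subset\operatorname{Ker}F_{\ast}$. Then, for every $m\in M$, there exist an open neighborhood $U$ of $m$ and a fibration $\pi:U\rightarrow\pi(U)\subset\mathbb{R}^{d-l}$ such that $$(\pi,F|_U):U\rightarrow\pi(U)\times F(U)$$ is a diffeomorphism and $\Sigma:=(\pi,F|_U)^{-1}$ is a complete solution of the $\pi$-HJE for $(U,X|_U)$. Moreover, $F|_U$ is the global momentum map related to $\Sigma$.
   Context: All manifolds are smooth and finite-dimensional and all maps are smooth; $f_*$ denotes the tangent map of $f$. A fibration is a surjective submersion. A dynamical system $(M,X)$ is a manifold $M$ with a vector field $X$ on $M$. Given a fibration $\Pi:M\to N$, a section $\sigma:N\to M$ of $\Pi$ is a solution of the $\Pi$-Hamilton-Jacobi equation ($\Pi$-HJE) for $(M,X)$ if $\sigma_{\ast}\circ\Pi_{\ast}\circ X\circ\sigma=X\circ\sigma$. Let $\Lambda$ be a manifold of dimension $\dim M-\dim N$. A complete solution of the $\Pi$-HJE for $(M,X)$ is a surjective local diffeomorphism $\Sigma:N\times\Lambda\to M$ such that, for each $\lambda\in\Lambda$, the map $\sigma_\lambda:=\Sigma(\cdot,\lambda):N\to M$ is a section of $\Pi$ that is a solution of the $\Pi$-HJE for $(M,X)$. In the claim this is applied to the system $(U,X|_U)$ with the fibration $\pi:U\to\pi(U)$ (and with $F(U)$ in place of $\Lambda$).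 If a complete solution $\Sigma:N\times\Lambda\to M$ is a global diffeomorphism, the global momentum map related to $\Sigma$ is $p_\Lambda\circ\Sigma^{-1}:M\to\Lambda$, with $p_\Lambda:N\times\Lambda\to\Lambda$ the canonical projection. *)

theory Defs
  imports "HOL-Analysis.Analysis"
begin

text \<open>
  The model space of a manifold is a linear subspace \<open>V\<close> of a Euclidean space, and the dimension of
  the manifold is \<open>dim V\<close>. Every type of class \<open>euclidean_space\<close> has positive dimension, so working
  with subspaces (rather than with whole types) is what makes dimension 0 available;
  \<open>V = UNIV\<close> gives back the ordinary \<open>R^n\<close>, and \<open>V = {0}\<close> gives \<open>R^0\<close>.
\<close>

text \<open>
  \<open>C_k_on k V S f\<close>: \<open>f\<close> is of class \<open>C^k\<close> on \<open>S\<close>, where \<open>S\<close> is meant to be a relatively open subset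
  of the subspace \<open>V\<close>. The derivative within \<open>S\<close> is determined only on \<open>V\<close>, hence only directions
  in \<open>V\<close> occur.
\<close>

primrec C_k_on ::
  "nat \<Rightarrow> 'e::euclidean_space set \<Rightarrow> 'e set \<Rightarrow> ('e \<Rightarrow> 'f::euclidean_space) \<Rightarrow> bool" where
  "C_k_on 0 V S f \<longleftrightarrow> continuous_on S f"
| "C_k_on (Suc k) V S f \<longleftrightarrow>
     (\<exists>f'. (\<forall>x\<in>S. (f has_derivative f' x) (at x within S)) \<and>
           (\<forall>v\<in>V. C_k_on k V S (\<lambda>x. f' x v)))"

definition smooth_on ::
  "'e::euclidean_space set \<Rightarrow> 'e set \<Rightarrow> ('e \<Rightarrow> 'f::euclidean_space) \<Rightarrow> bool" where
  "smooth_on V S f \<longleftrightarrow> (\<forall>k. C_k_on k V S f)"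


text \<open>
  A chart is a pair \<open>(W, \<phi>)\<close> of its domain and its coordinate map; only the values of \<open>\<phi>\<close> on \<open>W\<close>
  matter. The atlas is not required to be maximal; all notions below depend only on the smooth
  structure that it generates.
\<close>

record ('a, 'e) manifold =
  topo :: "'a topology"
  model :: "'e set"
  charts :: "('a set \<times> ('a \<Rightarrow> 'e)) set"

abbreviation pts :: "('a, 'e) manifold \<Rightarrow> 'a set" where
  "pts M \<equiv> topspace (topo M)"

definition mdim :: "('a, 'e::euclidean_space) manifold \<Rightarrow> nat" where
  "mdim M = dim (model M)"

definition smooth_manifold :: "('a, 'e::euclidean_space) manifold \<Rightarrow> bool" where
  "smooth_manifold M \<longleftrightarrow>
     Hausdorff_space (topo M) \<and> second_countable (topo M) \<and> subspace (model M) \<and>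
     (\<Union>(W, \<phi>)\<in>charts M. W) = pts M \<and>
     (\<forall>(W, \<phi>)\<in>charts M.
        openin (topo M) W \<and>
        openin (top_of_set (model M)) (\<phi> ` W) \<and>
        homeomorphic_map (subtopology (topo M) W) (top_of_set (\<phi> ` W)) \<phi>) \<and>
     (\<forall>(W, \<phi>)\<in>charts M. \<forall>(W', \<phi>')\<in>charts M.
        smooth_on (model M) (\<phi> ` (W \<inter> W')) (\<phi>' \<circ> inv_into W \<phi>))"

definition smooth_map ::
  "('a, 'e::euclidean_space) manifold \<Rightarrow> ('b, 'g::euclidean_space) manifold \<Rightarrow> ('a \<Rightarrow> 'b) \<Rightarrow> bool" where
  "smooth_map M N f \<longleftrightarrow>
     continuous_map (topo M) (topo N) f \<and>
     (\<forall>(W, \<phi>)\<in>charts M. \<forall>(W', \<psi>)\<in>charts N.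
        smooth_on (model M) (\<phi> ` {x \<in> W. f x \<in> W'}) (\<psi> \<circ> f \<circ> inv_into W \<phi>))"

definition diffeomorphism ::
  "('a, 'e::euclidean_space) manifold \<Rightarrow> ('b, 'g::euclidean_space) manifold \<Rightarrow> ('a \<Rightarrow> 'b) \<Rightarrow> bool" where
  "diffeomorphism M N f \<longleftrightarrow>
     bij_betw f (pts M) (pts N) \<and> smooth_map M N f \<and> smooth_map N M (inv_into (pts M) f)"

definition euclidean_manifold :: "'e::euclidean_space set \<Rightarrow> ('e, 'e) manifold" where
  "euclidean_manifold V = \<lparr>topo = top_of_set V, model = V, charts = {(V, \<lambda>x. x)}\<rparr>"

text \<open>Meant for \<open>U\<close> open in \<open>M\<close>.\<close>

definition open_submanifold :: "('a, 'e) manifold \<Rightarrow> 'a set \<Rightarrow> ('a, 'e) manifold" where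
  "open_submanifold M U =
     \<lparr>topo = subtopology (topo M) U, model = model M,
      charts = {(W \<inter> U, \<phi>) | W \<phi>. (W, \<phi>) \<in> charts M}\<rparr>"

definition product_manifold ::
  "('a, 'e) manifold \<Rightarrow> ('b, 'g) manifold \<Rightarrow> ('a \<times> 'b, 'e \<times> 'g) manifold" where
  "product_manifold M N =
     \<lparr>topo = prod_topology (topo M) (topo N), model = model M \<times> model N,
      charts = {(W \<times> W', map_prod \<phi> \<psi>) | W \<phi> W' \<psi>. (W, \<phi>) \<in> charts M \<and> (W', \<psi>) \<in> charts N}\<rparr>"

definition local_diffeomorphism ::
  "('a, 'e::euclidean_space) manifold \<Rightarrow> ('b, 'g::euclidean_space) manifold \<Rightarrow> ('a \<Rightarrow> 'b) \<Rightarrow> bool" where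
  "local_diffeomorphism M N f \<longleftrightarrow>
     (\<forall>x\<in>pts M. \<exists>W. openin (topo M) W \<and> x \<in> W \<and> openin (topo N) (f ` W) \<and>
        diffeomorphism (open_submanifold M W) (open_submanifold N (f ` W)) f)"


text \<open>
  Tangent vectors are classes of smooth curves having the same velocity at parameter 0 in the charts.
  A curve is a total function on the reals of which only the germ at 0 is relevant. Consequently,
  for \<open>U\<close> open in \<open>M\<close> and \<open>p \<in> U\<close>, the tangent spaces of \<open>M\<close> and of \<open>open_submanifold M U\<close> at \<open>p\<close> are
  the same set, and the restriction of a vector field \<open>X\<close> on \<open>M\<close> to \<open>U\<close> is given by \<open>X\<close> itself.
  The class determines the base point, so tangent vectors at distinct points are distinct.
\<close>

definition curve_at :: "('a, 'e::euclidean_space) manifold \<Rightarrow> 'a \<Rightarrow> (real \<Rightarrow> 'a) \<Rightarrow> bool" where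
  "curve_at M p \<gamma> \<longleftrightarrow>
     \<gamma> 0 = p \<and>
     (\<exists>\<epsilon>>0. smooth_map (open_submanifold (euclidean_manifold (UNIV :: real set)) {-\<epsilon><..<\<epsilon>}) M \<gamma>)"

definition tangent_class ::
  "('a, 'e::euclidean_space) manifold \<Rightarrow> (real \<Rightarrow> 'a) \<Rightarrow> (real \<Rightarrow> 'a) set" where
  "tangent_class M \<gamma> =
     {\<delta>. curve_at M (\<gamma> 0) \<delta> \<and>
         (\<forall>(W, \<phi>)\<in>charts M. \<gamma> 0 \<in> W \<longrightarrow>
            vector_derivative (\<phi> \<circ> \<delta>) (at 0) = vector_derivative (\<phi> \<circ> \<gamma>) (at 0))}"

definition tangent_space ::
  "('a, 'e::euclidean_space) manifold \<Rightarrow> 'a \<Rightarrow> (real \<Rightarrow> 'a) set set" where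
  "tangent_space M p = {tangent_class M \<gamma> | \<gamma>. curve_at M p \<gamma>}"

definition zero_tangent ::
  "('a, 'e::euclidean_space) manifold \<Rightarrow> 'a \<Rightarrow> (real \<Rightarrow> 'a) set" where
  "zero_tangent M p = tangent_class M (\<lambda>_. p)"

text \<open>
  \<open>tangent_map N f v\<close> is \<open>f\<^sub>* v\<close> for a map \<open>f\<close> into \<open>N\<close>: the class of \<open>f \<circ> \<gamma>\<close>, for any \<open>\<gamma> \<in> v\<close> (the
  union is over equal sets).
\<close>

definition tangent_map ::
  "('b, 'g::euclidean_space) manifold \<Rightarrow> ('a \<Rightarrow> 'b) \<Rightarrow> (real \<Rightarrow> 'a) set \<Rightarrow> (real \<Rightarrow> 'b) set" where
  "tangent_map N f v = (\<Union>\<gamma>\<in>v. tangent_class N (f \<circ> \<gamma>))"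

definition tangent_kernel ::
  "('a, 'e::euclidean_space) manifold \<Rightarrow> ('b, 'g::euclidean_space) manifold \<Rightarrow> ('a \<Rightarrow> 'b) \<Rightarrow>
   (real \<Rightarrow> 'a) set set" where
  "tangent_kernel M N f =
     {v. \<exists>p\<in>pts M. v \<in> tangent_space M p \<and> tangent_map N f v = zero_tangent N (f p)}"

definition chart_velocity :: "('a \<Rightarrow> 'e::euclidean_space) \<Rightarrow> (real \<Rightarrow> 'a) set \<Rightarrow> 'e" where
  "chart_velocity \<phi> v = (THE w. \<forall>\<gamma>\<in>v. ((\<phi> \<circ> \<gamma>) has_vector_derivative w) (at 0))"

definition vector_field ::
  "('a, 'e::euclidean_space) manifold \<Rightarrow> ('a \<Rightarrow> (real \<Rightarrow> 'a) set) \<Rightarrow> bool" where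
  "vector_field M X \<longleftrightarrow>
     (\<forall>p\<in>pts M. X p \<in> tangent_space M p) \<and>
     (\<forall>(W, \<phi>)\<in>charts M.
        smooth_on (model M) (\<phi> ` W) (\<lambda>y. chart_velocity \<phi> (X (inv_into W \<phi> y))))"

definition dynamical_system ::
  "('a, 'e::euclidean_space) manifold \<Rightarrow> ('a \<Rightarrow> (real \<Rightarrow> 'a) set) \<Rightarrow> bool" where
  "dynamical_system M X \<longleftrightarrow> smooth_manifold M \<and> vector_field M X"

definition fibration ::
  "('a, 'e::euclidean_space) manifold \<Rightarrow> ('b, 'g::euclidean_space) manifold \<Rightarrow> ('a \<Rightarrow> 'b) \<Rightarrow> bool" where
  "fibration M N f \<longleftrightarrow>
     smooth_manifold M \<and> smooth_manifold N \<and> smooth_map M N f \<and> f ` pts M = pts N \<and>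
     (\<forall>p\<in>pts M. tangent_map N f ` tangent_space M p = tangent_space N (f p))"


definition smooth_section ::
  "('a, 'e::euclidean_space) manifold \<Rightarrow> ('b, 'g::euclidean_space) manifold \<Rightarrow> ('a \<Rightarrow> 'b) \<Rightarrow>
   ('b \<Rightarrow> 'a) \<Rightarrow> bool" where
  "smooth_section M N \<Psi> \<sigma> \<longleftrightarrow> smooth_map N M \<sigma> \<and> (\<forall>x\<in>pts N. \<Psi> (\<sigma> x) = x)"

definition HJE_solution ::
  "('a, 'e::euclidean_space) manifold \<Rightarrow> ('a \<Rightarrow> (real \<Rightarrow> 'a) set) \<Rightarrow>
   ('b, 'g::euclidean_space) manifold \<Rightarrow> ('a \<Rightarrow> 'b) \<Rightarrow> ('b \<Rightarrow> 'a) \<Rightarrow> bool" where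
  "HJE_solution M X N \<Psi> \<sigma> \<longleftrightarrow>
     smooth_section M N \<Psi> \<sigma> \<and>
     (\<forall>x\<in>pts N. tangent_map M \<sigma> (tangent_map N \<Psi> (X (\<sigma> x))) = X (\<sigma> x))"

definition complete_solution ::
  "('a, 'e::euclidean_space) manifold \<Rightarrow> ('a \<Rightarrow> (real \<Rightarrow> 'a) set) \<Rightarrow>
   ('b, 'g::euclidean_space) manifold \<Rightarrow> ('a \<Rightarrow> 'b) \<Rightarrow> ('c, 'h::euclidean_space) manifold \<Rightarrow>
   ('b \<times> 'c \<Rightarrow> 'a) \<Rightarrow> bool" where
  "complete_solution M X N \<Psi> L \<Sigma> \<longleftrightarrow>
     dynamical_system M X \<and> fibration M N \<Psi> \<and>
     smooth_manifold L \<and> mdim L + mdim N = mdim M \<and>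
     local_diffeomorphism (product_manifold N L) M \<Sigma> \<and>
     \<Sigma> ` (pts N \<times> pts L) = pts M \<and>
     (\<forall>l\<in>pts L. HJE_solution M X N \<Psi> (\<lambda>x. \<Sigma> (x, l)))"

text \<open>
  \<open>global_momentum_map M N L \<Sigma> P\<close>: \<open>\<Sigma>\<close> is a global diffeomorphism and \<open>P\<close> agrees on \<open>M\<close> with
  \<open>p\<^sub>L \<circ> \<Sigma>\<inverse>\<close>.
\<close>

definition global_momentum_map ::
  "('a, 'e::euclidean_space) manifold \<Rightarrow> ('b, 'g::euclidean_space) manifold \<Rightarrow>
   ('c, 'h::euclidean_space) manifold \<Rightarrow> ('b \<times> 'c \<Rightarrow> 'a) \<Rightarrow> ('a \<Rightarrow> 'c) \<Rightarrow> bool" where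
  "global_momentum_map M N L \<Sigma> P \<longleftrightarrow>
     diffeomorphism (product_manifold N L) M \<Sigma> \<and>
     (\<forall>x\<in>pts M. P x = (snd \<circ> inv_into (pts N \<times> pts L) \<Sigma>) x)"

end

theory Submission
  imports Defs
begin

text \<open>
Near \<open>m\<close> the submersion \<open>F\<close> looks like the projection of a product onto one factor. Take charts
\<open>\<phi>\<close> at \<open>m\<close> and \<open>\<psi>\<close> at \<open>F m\<close>. Surjectivity of \<open>F\<^sub>*\<close> on the tangent space at \<open>m\<close> says that the derivative \<open>D\<close>
of the coordinate expression of \<open>F\<close> maps the model space of \<open>M\<close> onto that of \<open>L\<close>, so its kernel has
dimension \<open>d - l = dim K\<close>. A linear map \<open>A\<close> that carries the kernel isomorphically onto \<open>K\<close> makes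
\<open>(A, D)\<close> an isomorphism onto \<open>K \<times> model L\<close>. With \<open>\<pi> = A \<circ> \<phi>\<close>, the inverse function theorem turns \<open>(\<pi>, F)\<close>
into a diffeomorphism of a neighbourhood of \<open>m\<close> onto an open set, which contains the product of two open sets
as a neighbourhood of the image of \<open>m\<close>; the preimage of this product is \<open>U\<close>
(\<open>submersion_local_trivialisation\<close>).

Let \<open>\<Sigma>\<close> be the inverse diffeomorphism and \<open>\<sigma> = \<Sigma>(\<cdot>, l)\<close>. Write \<open>X(p)\<close>, for \<open>p = \<sigma>(a)\<close>, as the velocity of a
curve \<open>\<gamma>\<close>. Since \<open>F\<^sub>* X = 0\<close>, the curves \<open>(\<pi> \<circ> \<gamma>, F \<circ> \<gamma>)\<close> and \<open>(\<pi> \<circ> \<gamma>, l)\<close> have the same velocity at \<open>0\<close>.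
Applying \<open>\<Sigma>\<close> to the first curve gives back \<open>\<gamma>\<close>, and applying it to the second one gives
\<open>\<sigma> \<circ> \<pi> \<circ> \<gamma>\<close>, whose velocity is \<open>\<sigma>\<^sub>* \<pi>\<^sub>* X(p)\<close>. Hence \<open>\<sigma>\<^sub>* \<pi>\<^sub>* X(p) = X(p)\<close>, which is the Hamilton-Jacobi
equation (\<open>HJE_solution_of_product\<close>). The map \<open>\<pi>\<close> is a submersion because a section of it passes through
every point (\<open>fibration_if_sections\<close>), and \<open>F\<close> is the second component of \<open>\<Sigma>\<inverse>\<close> by construction.

Two bodies of theory support this argument. The first is the calculus of \<open>C_k_on\<close> with the inverse function
theorem for smooth maps between open subsets of linear subspaces (\<open>smooth_local_inverse\<close>). The second
is the functoriality of tangent classes (\<open>tangent_map_class\<close>): by the chain rule, the velocity of a curve in one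
chart determines the velocities of its images under smooth maps in all charts.
\<close>

section \<open>Calculus on relatively open subsets of a subspace\<close>

lemma C_k_on_SucI:
  assumes "\<And>x. x \<in> S \<Longrightarrow> (f has_derivative f' x) (at x within S)"
    and "\<And>v. v \<in> V \<Longrightarrow> C_k_on k V S (\<lambda>x. f' x v)"
  shows "C_k_on (Suc k) V S f"
  using assms unfolding C_k_on.simps by blast

lemma C_k_on_SucE:
  assumes "C_k_on (Suc k) V S f"
  obtains f' where "\<And>x. x \<in> S \<Longrightarrow> (f has_derivative f' x) (at x within S)"
    and "\<And>v. v \<in> V \<Longrightarrow> C_k_on k V S (\<lambda>x. f' x v)"
  using assms unfolding C_k_on.simps by blast

lemma C_k_on_cong:
  assumes "\<And>x. x \<in> S \<Longrightarrow> f x = g x" and "C_k_on k V S f"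
  shows "C_k_on k V S g"
proof (cases k)
  case 0
  then show ?thesis
    using assms continuous_on_cong by force
next
  case (Suc n)
  then obtain f' where f': "\<forall>x\<in>S. (f has_derivative f' x) (at x within S)"
    "\<forall>v\<in>V. C_k_on n V S (\<lambda>x. f' x v)"
    using assms by auto
  have "\<forall>x\<in>S. (g has_derivative f' x) (at x within S)"
    using f'(1) assms(1) by (metis has_derivative_transform)
  then show ?thesis
    using f'(2) Suc by auto
qed

lemma C_k_on_subset:
  assumes "T \<subseteq> S" and "C_k_on k V S f"
  shows "C_k_on k V T f"
  using assms(2)
proof (induction k arbitrary: f)
  case 0
  then show ?case
    using assms(1) continuous_on_subset by auto
next
  case (Suc k)
  then obtain f' where f': "\<forall>x\<in>S. (f has_derivative f' x) (at x within S)"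
    "\<forall>v\<in>V. C_k_on k V S (\<lambda>x. f' x v)"
    by auto
  then have "\<forall>x\<in>T. (f has_derivative f' x) (at x within T)"
    using assms(1) has_derivative_subset by blast
  then show ?case
    using f'(2) Suc.IH by auto
qed

lemma C_k_on_lower: "C_k_on (Suc k) V S f \<Longrightarrow> C_k_on k V S f"
proof (induction k arbitrary: f)
  case 0
  then show ?case
    by (auto intro: has_derivative_continuous_on)
next
  case (Suc k)
  then show ?case
    using C_k_on.simps(2) by metis
qed

lemma C_k_on_const: "C_k_on k V S (\<lambda>_. c)"
proof (induction k arbitrary: c)
  case 0
  show ?case
    by simp
next
  case (Suc k)
  show ?case
    by (rule C_k_on_SucI[where f' = "\<lambda>_ _. 0"]) (rule has_derivative_const Suc.IH)+
qed

lemma C_k_on_bounded_linear: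
  assumes h: "bounded_linear h" and "C_k_on k V S f"
  shows "C_k_on k V S (\<lambda>x. h (f x))"
  using assms(2)
proof (induction k arbitrary: f)
  case 0
  then show ?case
    using h by (simp add: bounded_linear.continuous_on)
next
  case (Suc k)
  from Suc.prems obtain f' where f': "\<And>x. x \<in> S \<Longrightarrow> (f has_derivative f' x) (at x within S)"
    "\<And>v. v \<in> V \<Longrightarrow> C_k_on k V S (\<lambda>x. f' x v)"
    by (rule C_k_on_SucE) (rule that)
  show ?case
  proof (rule C_k_on_SucI[where f' = "\<lambda>x v. h (f' x v)"])
    show "((\<lambda>x. h (f x)) has_derivative (\<lambda>v. h (f' x v))) (at x within S)" if "x \<in> S" for x
      using bounded_linear.has_derivative[OF h f'(1)[OF that]] .
  qed (use Suc.IH f'(2) in blast)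
qed

lemma C_k_on_ident: "C_k_on k V S (\<lambda>x. x)"
proof (cases k)
  case (Suc n)
  show ?thesis
    unfolding Suc
    by (rule C_k_on_SucI[where f' = "\<lambda>_ v. v"]) (rule has_derivative_ident C_k_on_const)+
qed simp

lemma C_k_on_linear: "linear h \<Longrightarrow> C_k_on k V S h"
  using C_k_on_bounded_linear[OF _ C_k_on_ident] linear_conv_bounded_linear by blast

lemma C_k_on_add:
  assumes "C_k_on k V S f" and "C_k_on k V S g"
  shows "C_k_on k V S (\<lambda>x. f x + g x)"
  using assms
proof (induction k arbitrary: f g)
  case 0
  then show ?case
    by (simp add: continuous_on_add)
next
  case (Suc k)
  from Suc.prems(1) obtain f' where f': "\<And>x. x \<in> S \<Longrightarrow> (f has_derivative f' x) (at x within S)"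
    "\<And>v. v \<in> V \<Longrightarrow> C_k_on k V S (\<lambda>x. f' x v)"
    by (rule C_k_on_SucE) (rule that)
  from Suc.prems(2) obtain g' where g': "\<And>x. x \<in> S \<Longrightarrow> (g has_derivative g' x) (at x within S)"
    "\<And>v. v \<in> V \<Longrightarrow> C_k_on k V S (\<lambda>x. g' x v)"
    by (rule C_k_on_SucE) (rule that)
  show ?case
  proof (rule C_k_on_SucI[where f' = "\<lambda>x v. f' x v + g' x v"])
    show "((\<lambda>x. f x + g x) has_derivative (\<lambda>v. f' x v + g' x v)) (at x within S)"
      if "x \<in> S" for x
      using has_derivative_add f'(1) g'(1) that by blast
  qed (use Suc.IH f'(2) g'(2) in blast)
qed

lemma C_k_on_sum:
  assumes "finite B" and "\<And>b. b \<in> B \<Longrightarrow> C_k_on k V S (f b)"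
  shows "C_k_on k V S (\<lambda>x. \<Sum>b\<in>B. f b x)"
  using assms
proof (induction B rule: finite_induct)
  case (insert b B)
  then show ?case
    using C_k_on_add[of k V S "f b"] by simp
qed (simp add: C_k_on_const)

lemma C_k_on_scaleR:
  fixes p :: "'e::euclidean_space \<Rightarrow> real"
  assumes "C_k_on k V S p" and "C_k_on k V S q"
  shows "C_k_on k V S (\<lambda>x. p x *\<^sub>R q x)"
  using assms
proof (induction k arbitrary: p q)
  case 0
  then show ?case
    by (simp add: continuous_on_scaleR)
next
  case (Suc k)
  from Suc.prems(1) obtain p' where p': "\<And>x. x \<in> S \<Longrightarrow> (p has_derivative p' x) (at x within S)"
    "\<And>v. v \<in> V \<Longrightarrow> C_k_on k V S (\<lambda>x. p' x v)"
    by (rule C_k_on_SucE) (rule that)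
  from Suc.prems(2) obtain q' where q': "\<And>x. x \<in> S \<Longrightarrow> (q has_derivative q' x) (at x within S)"
    "\<And>v. v \<in> V \<Longrightarrow> C_k_on k V S (\<lambda>x. q' x v)"
    by (rule C_k_on_SucE) (rule that)
  have pq: "C_k_on k V S p" "C_k_on k V S q"
    using Suc.prems C_k_on_lower by blast+
  show ?case
  proof (rule C_k_on_SucI[where f' = "\<lambda>x v. p x *\<^sub>R q' x v + p' x v *\<^sub>R q x"])
    show "((\<lambda>x. p x *\<^sub>R q x) has_derivative (\<lambda>v. p x *\<^sub>R q' x v + p' x v *\<^sub>R q x)) (at x within S)"
      if "x \<in> S" for x
      using has_derivative_scaleR p'(1) q'(1) that by blast
    show "C_k_on k V S (\<lambda>x. p x *\<^sub>R q' x v + p' x v *\<^sub>R q x)" if "v \<in> V" for v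
      using C_k_on_add[OF Suc.IH[OF pq(1) q'(2)[OF that]] Suc.IH[OF p'(2)[OF that] pq(2)]] .
  qed
qed

lemma C_k_on_Pair:
  assumes "C_k_on k V S f" and "C_k_on k V S g"
  shows "C_k_on k V S (\<lambda>x. (f x, g x))"
proof -
  have "bounded_linear (\<lambda>y::'b. (y, 0::'c))" "bounded_linear (\<lambda>z::'c. (0::'b, z))"
    by (auto intro!: bounded_linear_Pair bounded_linear_ident bounded_linear_zero)
  then have "C_k_on k V S (\<lambda>x. (f x, 0) + (0, g x))"
    using C_k_on_add[OF C_k_on_bounded_linear[OF _ assms(1)] C_k_on_bounded_linear[OF _ assms(2)]]
    by blast
  then show ?thesis
    by simp
qed

text \<open>
Lines through a point of \<open>S\<close> with direction in \<open>V\<close> stay in \<open>S\<close> for a short time. This reduces questions about the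
derivative within \<open>S\<close>, which is determined on \<open>V\<close> only, to curves in one real variable.
\<close>

lemma has_derivative_along_line:
  assumes "subspace V" "openin (top_of_set V) S" "x \<in> S" "v \<in> V"
    and f: "(f has_derivative D) (at x within S)"
  shows "((\<lambda>t. f (x + t *\<^sub>R v)) has_vector_derivative D v) (at 0)"
proof -
  obtain U where U: "open U" "S = V \<inter> U"
    using assms(2) by (auto simp: openin_open)
  define I where "I = {t::real. x + t *\<^sub>R v \<in> U}"
  have "open I"
    using open_vimage[OF U(1), of "\<lambda>t::real. x + t *\<^sub>R v"]
    by (simp add: I_def vimage_def continuous_intros)
  have "0 \<in> I"
    using assms(3) U by (auto simp: I_def)
  have "x + t *\<^sub>R v \<in> V" for t
    using assms(1,3,4) U subspace_add subspace_mul by blast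
  then have "(\<lambda>t. x + t *\<^sub>R v) ` I \<subseteq> S"
    using U by (auto simp: I_def)
  then have "(f has_derivative D) (at (x + 0 *\<^sub>R v) within (\<lambda>t. x + t *\<^sub>R v) ` I)"
    using has_derivative_subset[OF f] by simp
  moreover have "((\<lambda>t. x + t *\<^sub>R v) has_derivative (\<lambda>t. t *\<^sub>R v)) (at 0 within I)"
    using has_derivative_add[OF has_derivative_const has_derivative_scaleR_left[OF has_derivative_ident]]
    by simp
  ultimately have "(f \<circ> (\<lambda>t. x + t *\<^sub>R v) has_derivative D \<circ> (\<lambda>t. t *\<^sub>R v)) (at 0 within I)"
    by (intro diff_chain_within)
  moreover have "D \<circ> (\<lambda>t. t *\<^sub>R v) = (\<lambda>t. t *\<^sub>R D v)"
    using has_derivative_bounded_linear[OF f]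
    by (simp add: o_def linear_simps)
  ultimately show ?thesis
    using at_within_open[OF \<open>0 \<in> I\<close> \<open>open I\<close>] by (simp add: has_vector_derivative_def o_def)
qed

lemma has_derivative_unique_on_subspace:
  assumes "subspace V" "openin (top_of_set V) S" "x \<in> S" "v \<in> V"
    and "(f has_derivative D) (at x within S)" "(f has_derivative E) (at x within S)"
  shows "D v = E v"
  using has_derivative_along_line[OF assms(1-5)] has_derivative_along_line[OF assms(1-4,6)]
  by (rule vector_derivative_unique_at)

lemma has_vector_derivative_in_subspace:
  fixes \<gamma> :: "real \<Rightarrow> 'e::euclidean_space"
  assumes "subspace V" "(\<gamma> has_vector_derivative w) (at 0)" "\<forall>\<^sub>F t in nhds 0. \<gamma> t \<in> V"
  shows "w \<in> V"
proof -
  have "((\<lambda>t. (\<gamma> t - \<gamma> 0) /\<^sub>R t) \<longlongrightarrow> w) (at 0)"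
  proof (rule Lim_null[THEN iffD2], rule tendsto_norm_zero_cancel, rule Lim_transform_eventually)
    show "((\<lambda>t. norm (\<gamma> t - \<gamma> 0 - t *\<^sub>R w) / norm t) \<longlongrightarrow> 0) (at 0)"
      using assms(2) by (simp add: has_vector_derivative_def has_derivative_iff_norm)
    have "norm (\<gamma> t - \<gamma> 0 - t *\<^sub>R w) / norm t = norm ((\<gamma> t - \<gamma> 0) /\<^sub>R t - w)" if "t \<noteq> 0" for t
    proof -
      have "(\<gamma> t - \<gamma> 0) /\<^sub>R t - w = (\<gamma> t - \<gamma> 0 - t *\<^sub>R w) /\<^sub>R t"
        using that by (simp add: scaleR_diff_right)
      then show ?thesis
        by (simp add: divide_inverse mult.commute)
    qed
    then show "\<forall>\<^sub>F t in at 0. norm (\<gamma> t - \<gamma> 0 - t *\<^sub>R w) / norm t = norm ((\<gamma> t - \<gamma> 0) /\<^sub>R t - w)"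
      by (simp add: eventually_at_filter)
  qed
  moreover have "\<gamma> 0 \<in> V"
    using assms(3) eventually_nhds_x_imp_x by blast
  then have "\<forall>\<^sub>F t in at 0. (\<gamma> t - \<gamma> 0) /\<^sub>R t \<in> V"
    using assms(3) assms(1) unfolding eventually_at_filter
    by (auto elim!: eventually_mono intro: subspace_mul subspace_diff)
  ultimately show ?thesis
    using Lim_in_closed_set[of V] closed_subspace[OF assms(1)] by (metis trivial_limit_at)
qed

text \<open>
In directions of \<open>V\<close> there is only one candidate for the derivative at a point, so the derivatives given on the
neighbourhoods agree on overlaps, and one may take at \<open>x\<close> the derivative that belongs to the neighbourhood of \<open>x\<close>.
\<close>

lemma C_k_on_local:
  assumes "subspace V"
    and "\<And>x. x \<in> S \<Longrightarrow> \<exists>T. openin (top_of_set V) T \<and> x \<in> T \<and> T \<subseteq> S \<and> C_k_on k V T f"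
  shows "C_k_on k V S f"
proof -
  have SV: "S \<subseteq> V"
    using assms(2) openin_imp_subset by (meson subsetD subsetI)
  show ?thesis
    using assms(2)
  proof (induction k arbitrary: f)
    case 0
    have "continuous_on S f" unfolding continuous_on_eq_continuous_within
    proof
      fix x assume "x \<in> S"
      then obtain T where T: "openin (top_of_set V) T" "x \<in> T" "T \<subseteq> S" "continuous_on T f"
        using 0[OF \<open>x \<in> S\<close>] unfolding C_k_on.simps by blast
      obtain O' where "open O'" "T = V \<inter> O'"
        using T by (auto simp: openin_open)
      then have "at x within S = at x within T"
        using T SV by (intro at_within_nhd[of _ O']) auto
      then show "continuous (at x within S) f"
        using T by (simp add: continuous_on_eq_continuous_within)
    qed
    then show ?case by simp
  next
    case (Suc k)
    obtain T where T: "\<And>x. x \<in> S \<Longrightarrow> openin (top_of_set V) (T x) \<and> x \<in> T x \<and> T x \<subseteq> S \<and>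
        C_k_on (Suc k) V (T x) f"
      using Suc.prems by (metis (no_types))
    have "\<forall>x. \<exists>D. x \<in> S \<longrightarrow> (\<forall>y\<in>T x. (f has_derivative D y) (at y within T x)) \<and>
        (\<forall>v\<in>V. C_k_on k V (T x) (\<lambda>y. D y v))"
      using T unfolding C_k_on.simps by meson
    from choice[OF this] obtain D where
      "\<forall>x. x \<in> S \<longrightarrow> (\<forall>y\<in>T x. (f has_derivative D x y) (at y within T x)) \<and>
        (\<forall>v\<in>V. C_k_on k V (T x) (\<lambda>y. D x y v))"
      by (rule exE)
    then have D: "(\<forall>y\<in>T x. (f has_derivative D x y) (at y within T x)) \<and>
        (\<forall>v\<in>V. C_k_on k V (T x) (\<lambda>y. D x y v))" if "x \<in> S" for x
      using that by blast
    have "(f has_derivative D x x) (at x within S)" if x: "x \<in> S" for x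
    proof -
      obtain O' where O': "open O'" "T x = V \<inter> O'"
        using T[OF x] by (auto simp: openin_open)
      then have "at x within S = at x within T x"
        using T[OF x] O' SV by (intro at_within_nhd[of _ O']) auto
      then show ?thesis
        using D[OF x] T[OF x] by simp
    qed
    moreover have "C_k_on k V S (\<lambda>x. D x x v)" if "v \<in> V" for v
    proof (rule Suc.IH)
      fix x assume x: "x \<in> S"
      have "D x y v = D y y v" if y: "y \<in> T x" for y
      proof -
        have "y \<in> S"
          using T[OF x] y by blast
        have "openin (top_of_set V) (T x \<inter> T y)" "y \<in> T x \<inter> T y"
          using T[OF x] T[OF \<open>y \<in> S\<close>] y by auto
        moreover have "(f has_derivative D x y) (at y within T x \<inter> T y)"
          using D[OF x] y has_derivative_subset by blast
        moreover have "(f has_derivative D y y) (at y within T x \<inter> T y)"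
          using D[OF \<open>y \<in> S\<close>] T[OF \<open>y \<in> S\<close>] has_derivative_subset by blast
        ultimately show ?thesis
          using has_derivative_unique_on_subspace assms(1) \<open>v \<in> V\<close> by metis
      qed
      moreover have "C_k_on k V (T x) (\<lambda>y. D x y v)"
        using D[OF x] that by blast
      ultimately have "C_k_on k V (T x) (\<lambda>y. D y y v)"
        by (rule C_k_on_cong)
      then show "\<exists>T. openin (top_of_set V) T \<and> x \<in> T \<and> T \<subseteq> S \<and> C_k_on k V T (\<lambda>x. D x x v)"
        using T[OF x] by blast
    qed
    ultimately show ?case
      by (rule C_k_on_SucI[where f' = "\<lambda>x. D x x"])
  qed
qed

text \<open>
The derivative of \<open>h\<close> takes values in \<open>V\<close>, because \<open>h\<close> does. Expanding it in an orthonormal basis of \<open>V\<close> turns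
the chain rule into a finite sum of products of a coefficient of \<open>h'\<close> with a partial derivative of \<open>f\<close> along a
basis vector, composed with \<open>h\<close>; the induction hypothesis applies to these partial derivatives.
\<close>

lemma C_k_on_compose:
  fixes f :: "'e::euclidean_space \<Rightarrow> 'f::euclidean_space" and h :: "'d::euclidean_space \<Rightarrow> 'e"
  assumes V: "subspace V" and W: "subspace W" and T: "openin (top_of_set W) T"
    and hT: "h ` T \<subseteq> S" and SV: "S \<subseteq> V"
    and "C_k_on k V S f" "C_k_on k W T h"
  shows "C_k_on k W T (\<lambda>x. f (h x))"
  using assms(6-)
proof (induction k arbitrary: f)
  case 0
  then show ?case
    using hT by (auto intro: continuous_on_compose2)
next
  case (Suc k)
  then obtain f' h' where f': "\<forall>x\<in>S. (f has_derivative f' x) (at x within S)"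
    "\<forall>v\<in>V. C_k_on k V S (\<lambda>x. f' x v)"
    and h': "\<forall>x\<in>T. (h has_derivative h' x) (at x within T)"
    "\<forall>v\<in>W. C_k_on k W T (\<lambda>x. h' x v)"
    by auto
  have der: "((\<lambda>x. f (h x)) has_derivative (\<lambda>w. f' (h x) (h' x w))) (at x within T)" if "x \<in> T" for x
  proof -
    have "(f has_derivative f' (h x)) (at (h x) within h ` T)"
      using f'(1) hT that has_derivative_subset by blast
    then show ?thesis
      using diff_chain_within[of h "h' x" x T f] h'(1) that by (auto simp: o_def)
  qed
  \<comment> \<open>an orthonormal basis of \<open>V\<close>, since the derivative of \<open>f\<close> is controlled in directions of \<open>V\<close> only\<close>
  obtain B where B: "B \<subseteq> V" "pairwise orthogonal B" "\<And>x. x \<in> B \<Longrightarrow> norm x = 1"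
      "independent B" "span B = V"
    using orthonormal_basis_subspace[OF V] by metis
  have "finite B"
    using B(4) independent_imp_finite by blast
  have expand: "(\<Sum>b\<in>B. (h' x w \<bullet> b) *\<^sub>R f' (h x) b) = f' (h x) (h' x w)"
    if "x \<in> T" "w \<in> W" for x w
  proof -
    have "((\<lambda>t. h (x + t *\<^sub>R w)) has_vector_derivative h' x w) (at 0)"
      using has_derivative_along_line[OF W T \<open>x \<in> T\<close> \<open>w \<in> W\<close>] h'(1) that by blast
    moreover have "\<forall>\<^sub>F t in nhds 0. h (x + t *\<^sub>R w) \<in> V"
    proof -
      obtain U where U: "open U" "T = W \<inter> U"
        using T by (auto simp: openin_open)
      have "((\<lambda>t. x + t *\<^sub>R w) \<longlongrightarrow> x + 0 *\<^sub>R w) (nhds 0)"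
        by (intro tendsto_intros filterlim_ident)
      then have "\<forall>\<^sub>F t in nhds 0. x + t *\<^sub>R w \<in> U"
        using topological_tendstoD U that by fastforce
      then show ?thesis
        using U that W hT SV by (auto elim!: eventually_mono intro: subspace_add subspace_mul)
    qed
    ultimately have "h' x w \<in> span B"
      using has_vector_derivative_in_subspace V B(5) by blast
    then have *: "(\<Sum>b\<in>B. (h' x w \<bullet> b) *\<^sub>R b) = h' x w"
      using orthonormal_basis_expand[OF B(2,3) _ \<open>finite B\<close>] by blast
    have "linear (f' (h x))"
      using f'(1) hT that has_derivative_linear by blast
    then have "f' (h x) (\<Sum>b\<in>B. (h' x w \<bullet> b) *\<^sub>R b) = (\<Sum>b\<in>B. (h' x w \<bullet> b) *\<^sub>R f' (h x) b)"
      by (simp add: linear_sum linear_cmul)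
    then show ?thesis
      using * by simp
  qed
  have "C_k_on k W T (\<lambda>x. f' (h x) (h' x w))" if "w \<in> W" for w
  proof (rule C_k_on_cong[OF expand])
    have "C_k_on k W T (\<lambda>x. f' (h x) b)" if "b \<in> B" for b
      using Suc.IH f'(2) Suc.prems(2) C_k_on_lower B(1) that by blast
    moreover have "C_k_on k W T (\<lambda>x. h' x w \<bullet> b)" for b
      using C_k_on_bounded_linear[OF bounded_linear_inner_left] h'(2) that by blast
    ultimately show "C_k_on k W T (\<lambda>x. \<Sum>b\<in>B. (h' x w \<bullet> b) *\<^sub>R f' (h x) b)"
      by (intro C_k_on_sum[OF \<open>finite B\<close>] C_k_on_scaleR)
  qed (use that in auto)
  then show ?case
    using der by (auto intro!: exI[of _ "\<lambda>x w. f' (h x) (h' x w)"])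
qed

lemma smooth_on_cong:
  "smooth_on V S f \<Longrightarrow> (\<And>x. x \<in> S \<Longrightarrow> f x = g x) \<Longrightarrow> smooth_on V S g"
  unfolding smooth_on_def using C_k_on_cong by blast

lemma smooth_on_subset: "smooth_on V S f \<Longrightarrow> T \<subseteq> S \<Longrightarrow> smooth_on V T f"
  unfolding smooth_on_def using C_k_on_subset by blast

lemma smooth_on_linear: "linear h \<Longrightarrow> smooth_on V S h"
  unfolding smooth_on_def using C_k_on_linear by blast

lemma smooth_on_ident: "smooth_on V S (\<lambda>x. x)"
  unfolding smooth_on_def using C_k_on_ident by blast

lemma smooth_on_const: "smooth_on V S (\<lambda>_. c)"
  unfolding smooth_on_def using C_k_on_const by blast

lemma smooth_on_Pair:
  "smooth_on V S f \<Longrightarrow> smooth_on V S g \<Longrightarrow> smooth_on V S (\<lambda>x. (f x, g x))"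
  unfolding smooth_on_def using C_k_on_Pair by blast

lemma smooth_on_compose:
  assumes "subspace V" "subspace W" "openin (top_of_set W) T" "h ` T \<subseteq> S" "S \<subseteq> V"
    and "smooth_on V S f" "smooth_on W T h"
  shows "smooth_on W T (\<lambda>x. f (h x))"
  unfolding smooth_on_def
proof
  fix k
  have "C_k_on k V S f" "C_k_on k W T h"
    using assms(6,7) unfolding smooth_on_def by blast+
  then show "C_k_on k W T (\<lambda>x. f (h x))"
    by (rule C_k_on_compose[OF assms(1-5)])
qed

lemma smooth_on_local:
  assumes "subspace V"
    and "\<And>x. x \<in> S \<Longrightarrow> \<exists>T. openin (top_of_set V) T \<and> x \<in> T \<and> T \<subseteq> S \<and> smooth_on V T f"
  shows "smooth_on V S f"
  unfolding smooth_on_def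
proof
  fix k
  show "C_k_on k V S f"
  proof (rule C_k_on_local[OF assms(1)])
    fix x assume "x \<in> S"
    then show "\<exists>T. openin (top_of_set V) T \<and> x \<in> T \<and> T \<subseteq> S \<and> C_k_on k V T f"
      using assms(2)[of x] unfolding smooth_on_def by blast
  qed
qed

lemma smooth_on_imp_continuous_on: "smooth_on V S f \<Longrightarrow> continuous_on S f"
  unfolding smooth_on_def using C_k_on.simps(1) by blast

text \<open>
Smoothness provides for each order a derivative of its own; uniqueness in the directions of \<open>V\<close> identifies them, so
that one derivative serves all orders.
\<close>

lemma smooth_on_derivative:
  assumes V: "subspace V" and S: "openin (top_of_set V) S" and f: "smooth_on V S f"
  obtains f' where "\<And>x. x \<in> S \<Longrightarrow> (f has_derivative f' x) (at x within S)"
    and "\<And>v. v \<in> V \<Longrightarrow> smooth_on V S (\<lambda>x. f' x v)"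
proof -
  have "C_k_on (Suc 0) V S f"
    using f by (simp add: smooth_on_def del: C_k_on.simps)
  then obtain f' where f': "\<And>x. x \<in> S \<Longrightarrow> (f has_derivative f' x) (at x within S)"
    by (rule C_k_on_SucE) (rule that)
  have "C_k_on k V S (\<lambda>x. f' x v)" if "v \<in> V" for k v
  proof -
    have "C_k_on (Suc k) V S f"
      using f by (simp add: smooth_on_def del: C_k_on.simps)
    then obtain f'' where f'': "\<And>x. x \<in> S \<Longrightarrow> (f has_derivative f'' x) (at x within S)"
      "\<And>v. v \<in> V \<Longrightarrow> C_k_on k V S (\<lambda>x. f'' x v)"
      by (rule C_k_on_SucE) (rule that)
    have "f'' x v = f' x v" if "x \<in> S" for x
      using has_derivative_unique_on_subspace[OF V S that \<open>v \<in> V\<close>] f' f''(1) that by blast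
    then show ?thesis
      using f''(2)[OF \<open>v \<in> V\<close>] by (rule C_k_on_cong)
  qed
  then have "smooth_on V S (\<lambda>x. f' x v)" if "v \<in> V" for v
    using that by (simp add: smooth_on_def)
  then show thesis
    using that[OF f'] by blast
qed

section \<open>The smooth inverse function theorem on subspaces\<close>

text \<open>
Where the scalar factor vanishes, the product rule needs only continuity of the other factor, since
\<open>p y *\<^sub>R (q y - q x)\<close> is then of smaller order than \<open>y - x\<close>.
\<close>

lemma has_derivative_scaleR_zero:
  fixes p :: "'e::real_normed_vector \<Rightarrow> real" and q :: "'e \<Rightarrow> 'f::real_normed_vector"
  assumes p: "(p has_derivative p') (at x within S)" "p x = 0"
    and q: "continuous (at x within S) q"
  shows "((\<lambda>y. p y *\<^sub>R q y) has_derivative (\<lambda>v. p' v *\<^sub>R q x)) (at x within S)"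
proof -
  obtain C where C: "\<And>v. norm (p' v) \<le> norm v * C"
    using has_derivative_bounded_linear[OF p(1)] bounded_linear.bounded by blast
  define \<rho> where "\<rho> y = norm (p y - p x - p' (y - x)) / norm (y - x)" for y
  have \<rho>: "(\<rho> \<longlongrightarrow> 0) (at x within S)"
    using p(1) by (simp add: has_derivative_iff_norm \<rho>_def[abs_def])
  have "((\<lambda>y. norm (q y - q x)) \<longlongrightarrow> 0) (at x within S)"
    using q by (simp add: continuous_within LIM_zero tendsto_norm_zero)
  then have "((\<lambda>y. (\<rho> y + C) * norm (q y - q x)) \<longlongrightarrow> (0 + C) * 0) (at x within S)"
    using \<rho> by (intro tendsto_intros)
  then have lim: "((\<lambda>y. (\<rho> y + C) * norm (q y - q x)) \<longlongrightarrow> 0) (at x within S)"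
    by simp
  have bound: "norm (norm (p y *\<^sub>R (q y - q x)) / norm (y - x)) \<le> (\<rho> y + C) * norm (q y - q x)"
    if "y \<noteq> x" for y
  proof -
    have "norm (p y) \<le> norm (p y - p x - p' (y - x)) + norm (p' (y - x))"
      using p(2) by (metis diff_zero norm_triangle_sub add.commute norm_minus_commute)
    also have "\<dots> \<le> (\<rho> y + C) * norm (y - x)"
      using C[of "y - x"] that by (simp add: \<rho>_def algebra_simps)
    finally have "norm (p y) / norm (y - x) \<le> \<rho> y + C"
      using that by (simp add: divide_le_eq)
    then have "norm (p y) / norm (y - x) * norm (q y - q x) \<le> (\<rho> y + C) * norm (q y - q x)"
      by (rule mult_right_mono) simp
    then show ?thesis
      by simp
  qed
  have "((\<lambda>y. norm (p y *\<^sub>R (q y - q x)) / norm (y - x)) \<longlongrightarrow> 0) (at x within S)"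
    by (rule Lim_null_comparison[OF _ lim]) (use bound in \<open>simp add: eventually_at_filter\<close>)
  then have "((\<lambda>y. p y *\<^sub>R (q y - q x)) has_derivative (\<lambda>_. 0)) (at x within S)"
    using p(2) by (simp add: has_derivative_iff_norm)
  from has_derivative_add[OF has_derivative_scaleR_left[OF p(1), of "q x"] this]
  show ?thesis
    by (simp add: scaleR_diff_right)
qed

text \<open>
As \<open>A y\<close> tends to \<open>A x\<close>, the norms of the inverses \<open>R y\<close> remain bounded, and the identity
\<open>R y - R x = R y \<circ> (A x - A y) \<circ> R x\<close> gives convergence.
\<close>

lemma linear_family_inverse_continuous:
  fixes A R :: "'d::topological_space \<Rightarrow> 'e::euclidean_space \<Rightarrow> 'e"
  assumes A: "\<And>x. x \<in> T \<Longrightarrow> linear (A x)" and R: "\<And>x. x \<in> T \<Longrightarrow> linear (R x)"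
    and RA: "\<And>x v. x \<in> T \<Longrightarrow> R x (A x v) = v" and AR: "\<And>x v. x \<in> T \<Longrightarrow> A x (R x v) = v"
    and cont: "\<And>v. continuous_on T (\<lambda>x. A x v)"
  shows "continuous_on T (\<lambda>x. R x w)"
  unfolding continuous_on_def
proof
  fix x assume x: "x \<in> T"
  obtain C where C: "C > 0" "\<And>u. norm (R x u) \<le> C * norm u"
    using linear_bounded_pos[OF R[OF x]] by blast
  define \<delta> where "\<delta> y = (\<Sum>b\<in>Basis. norm (A y b - A x b))" for y
  have "(\<delta> \<longlongrightarrow> (\<Sum>b\<in>(Basis::'e set). norm (A x b - A x b))) (at x within T)"
    unfolding \<delta>_def using cont x by (intro tendsto_intros) (simp add: continuous_on_def)
  then have \<delta>: "(\<delta> \<longlongrightarrow> 0) (at x within T)"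
    by simp
  have diff: "norm (A y v - A x v) \<le> \<delta> y * norm v" if y: "y \<in> T" for y v
  proof -
    have "A y v - A x v = (\<Sum>b\<in>Basis. (v \<bullet> b) *\<^sub>R (A y b - A x b))"
      using linear_sum[OF A[OF y], of "\<lambda>b. (v \<bullet> b) *\<^sub>R b" Basis] linear_sum[OF A[OF x], of "\<lambda>b. (v \<bullet> b) *\<^sub>R b" Basis]
      by (simp add: euclidean_representation linear_cmul[OF A[OF y]] linear_cmul[OF A[OF x]]
          sum_subtractf scaleR_diff_right)
    also have "norm \<dots> \<le> (\<Sum>b\<in>Basis. norm v * norm (A y b - A x b))"
      by (rule sum_norm_le) (simp add: Basis_le_norm mult_right_mono)
    finally show ?thesis
      by (simp add: \<delta>_def sum_distrib_left mult.commute)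
  qed
  \<comment> \<open>for \<open>\<delta> y < 1 / (2 * C)\<close> the operator norm of \<open>R y\<close> is at most \<open>2 * C\<close>\<close>
  have bound: "norm (R y w - R x w) \<le> 2 * C * (\<delta> y * norm (R x w))" if y: "y \<in> T" "\<delta> y < 1 / (2 * C)" for y
  proof -
    have "norm (R y u) \<le> 2 * C * norm u" for u
    proof -
      have "norm (R y u) = norm (R x (A x (R y u)))"
        using RA[OF x] by simp
      also have "\<dots> \<le> C * norm (A x (R y u))"
        by (rule C(2))
      also have "norm (A x (R y u)) \<le> norm u + norm (A y (R y u) - A x (R y u))"
        using AR[OF y(1), of u] by (metis norm_triangle_sub norm_minus_commute add.commute)
      also have "norm (A y (R y u) - A x (R y u)) \<le> \<delta> y * norm (R y u)"
        by (rule diff[OF y(1)])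
      also have "\<delta> y * norm (R y u) \<le> 1 / (2 * C) * norm (R y u)"
        using y(2) by (intro mult_right_mono) auto
      finally have "norm (R y u) \<le> C * (norm u + 1 / (2 * C) * norm (R y u))"
        using C(1) by simp
      then show ?thesis
        using C(1) by (simp add: field_simps)
    qed
    then have "norm (R y (A x (R x w) - A y (R x w))) \<le> 2 * C * norm (A x (R x w) - A y (R x w))" .
    also have "R y (A x (R x w) - A y (R x w)) = R y w - R x w"
      using AR[OF x] RA[OF y(1)] by (simp add: linear_diff[OF R[OF y(1)]])
    also have "2 * C * norm (A x (R x w) - A y (R x w)) \<le> 2 * C * (\<delta> y * norm (R x w))"
      using C(1) diff[OF y(1), of "R x w"] by (simp add: norm_minus_commute)
    finally show ?thesis .
  qed
  have "((\<lambda>y. R y w - R x w) \<longlongrightarrow> 0) (at x within T)"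
  proof (rule Lim_null_comparison)
    have "\<forall>\<^sub>F y in at x within T. \<delta> y < 1 / (2 * C)"
      using order_tendstoD(2)[OF \<delta>, of "1 / (2 * C)"] C(1) by simp
    moreover have "\<forall>\<^sub>F y in at x within T. y \<in> T"
      by (simp add: eventually_at_filter)
    ultimately show "\<forall>\<^sub>F y in at x within T. norm (R y w - R x w) \<le> 2 * C * (\<delta> y * norm (R x w))"
      by eventually_elim (use bound in blast)
    have "((\<lambda>y. 2 * C * (\<delta> y * norm (R x w))) \<longlongrightarrow> 2 * C * (0 * norm (R x w))) (at x within T)"
      by (intro tendsto_intros \<delta>)
    then show "((\<lambda>y. 2 * C * (\<delta> y * norm (R x w))) \<longlongrightarrow> 0) (at x within T)"
      by simp
  qed
  then show "((\<lambda>y. R y w) \<longlongrightarrow> R x w) (at x within T)"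
    by (rule LIM_zero_cancel)
qed

text \<open>
Inversion of operators is differentiable with derivative \<open>- R \<circ> A' \<circ> R\<close>, an expression in \<open>A'\<close> and in \<open>R\<close> itself.
This starts a bootstrap: if \<open>A\<close> is \<open>C\<^sup>k\<^sup>+\<^sup>1\<close> and \<open>R\<close> is \<open>C\<^sup>k\<close>, then the derivative of \<open>R\<close> is \<open>C\<^sup>k\<close>. Compositions of
operators are written out in a basis, so that only sums and products of functions occur.
\<close>

lemma linear_family_inverse_C_k:
  fixes A R :: "'d::euclidean_space \<Rightarrow> 'e::euclidean_space \<Rightarrow> 'e"
  assumes A: "\<And>x. x \<in> T \<Longrightarrow> linear (A x)" and R: "\<And>x. x \<in> T \<Longrightarrow> linear (R x)"
    and RA: "\<And>x v. x \<in> T \<Longrightarrow> R x (A x v) = v" and AR: "\<And>x v. x \<in> T \<Longrightarrow> A x (R x v) = v"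
    and C: "\<And>v. C_k_on k V T (\<lambda>x. A x v)"
  shows "C_k_on k V T (\<lambda>x. R x w)"
  using C
proof (induction k arbitrary: w)
  case 0
  then have "continuous_on T (\<lambda>x. A x v)" for v
    by simp
  then show ?case
    using linear_family_inverse_continuous[where A = A, OF A R RA AR] by simp
next
  case (Suc k)
  have "\<forall>c. \<exists>A'. (\<forall>x\<in>T. ((\<lambda>x. A x c) has_derivative A' x) (at x within T)) \<and>
      (\<forall>v\<in>V. C_k_on k V T (\<lambda>x. A' x v))"
    using Suc.prems unfolding C_k_on.simps by (intro allI)
  from choice[OF this] obtain A' where "\<forall>c. (\<forall>x\<in>T. ((\<lambda>x. A x c) has_derivative A' c x) (at x within T)) \<and>
      (\<forall>v\<in>V. C_k_on k V T (\<lambda>x. A' c x v))"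
    by (rule exE)
  then have A': "\<And>c x. x \<in> T \<Longrightarrow> ((\<lambda>x. A x c) has_derivative A' c x) (at x within T)"
    and A'C: "\<And>c v. v \<in> V \<Longrightarrow> C_k_on k V T (\<lambda>x. A' c x v)"
    by blast+
  have IH: "C_k_on k V T (\<lambda>x. R x w)" for w
    by (rule Suc.IH) (rule C_k_on_lower[OF Suc.prems])
  have contR: "continuous_on T (\<lambda>x. R x w)" for w
  proof (rule linear_family_inverse_continuous[where A = A, OF A R RA AR])
    show "continuous_on T (\<lambda>x. A x v)" for v
      using A' by (rule has_derivative_continuous_on)
  qed
  define R' where "R' x v = - (\<Sum>e\<in>Basis. ((\<Sum>b\<in>Basis. (R x w \<bullet> b) *\<^sub>R A' b x v) \<bullet> e) *\<^sub>R R x e)" for x v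
  show ?case
  proof (rule C_k_on_SucI[where f' = R'])
    fix x assume x: "x \<in> T"
    define c where "c = R x w"
    have linA: "A y c = (\<Sum>b\<in>Basis. (c \<bullet> b) *\<^sub>R A y b)" if y: "y \<in> T" for y
      using linear_sum[OF A[OF y], of "\<lambda>b. (c \<bullet> b) *\<^sub>R b" Basis]
      by (simp add: euclidean_representation linear_cmul[OF A[OF y]])
    \<comment> \<open>\<open>R y w - R x w = - R y (A y c - A x c)\<close>, and the argument vanishes at \<open>x\<close>\<close>
    have eq: "c - (\<Sum>e\<in>Basis. ((A y c - w) \<bullet> e) *\<^sub>R R y e) = R y w" if y: "y \<in> T" for y
    proof -
      have "(\<Sum>e\<in>Basis. ((A y c - w) \<bullet> e) *\<^sub>R R y e) = R y (A y c - w)"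
        using linear_sum[OF R[OF y], of "\<lambda>e. ((A y c - w) \<bullet> e) *\<^sub>R e" Basis]
        by (simp add: euclidean_representation linear_cmul[OF R[OF y]])
      then show ?thesis
        by (simp add: linear_diff[OF R[OF y]] RA[OF y])
    qed
    have "((\<lambda>y. \<Sum>b\<in>Basis. (c \<bullet> b) *\<^sub>R A y b) has_derivative
        (\<lambda>v. \<Sum>b\<in>Basis. (c \<bullet> b) *\<^sub>R A' b x v)) (at x within T)"
      by (intro has_derivative_sum has_derivative_scaleR_right A' x)
    then have "((\<lambda>y. A y c) has_derivative (\<lambda>v. \<Sum>b\<in>Basis. (c \<bullet> b) *\<^sub>R A' b x v)) (at x within T)"
      by (rule has_derivative_transform[OF x, rotated]) (rule linA)
    from has_derivative_inner_left[OF has_derivative_diff[OF this has_derivative_const]]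
    have "((\<lambda>y. (A y c - w) \<bullet> e) has_derivative
        (\<lambda>v. (\<Sum>b\<in>Basis. (c \<bullet> b) *\<^sub>R A' b x v) \<bullet> e)) (at x within T)" for e
      by simp
    moreover have "(A x c - w) \<bullet> e = 0" for e
      using AR[OF x] by (simp add: c_def)
    moreover have "continuous (at x within T) (\<lambda>y. R y e)" for e
      using contR x by (simp add: continuous_on_eq_continuous_within)
    ultimately have "((\<lambda>y. ((A y c - w) \<bullet> e) *\<^sub>R R y e) has_derivative
        (\<lambda>v. ((\<Sum>b\<in>Basis. (c \<bullet> b) *\<^sub>R A' b x v) \<bullet> e) *\<^sub>R R x e)) (at x within T)" for e
      by (rule has_derivative_scaleR_zero)
    then have "((\<lambda>y. c - (\<Sum>e\<in>Basis. ((A y c - w) \<bullet> e) *\<^sub>R R y e)) has_derivative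
        (\<lambda>v. 0 - (\<Sum>e\<in>Basis. ((\<Sum>b\<in>Basis. (c \<bullet> b) *\<^sub>R A' b x v) \<bullet> e) *\<^sub>R R x e))) (at x within T)"
      by (intro has_derivative_diff has_derivative_const has_derivative_sum)
    moreover have "(\<lambda>v. 0 - (\<Sum>e\<in>Basis. ((\<Sum>b\<in>Basis. (c \<bullet> b) *\<^sub>R A' b x v) \<bullet> e) *\<^sub>R R x e)) = R' x"
      by (simp add: R'_def c_def fun_eq_iff)
    ultimately have "((\<lambda>y. c - (\<Sum>e\<in>Basis. ((A y c - w) \<bullet> e) *\<^sub>R R y e)) has_derivative R' x) (at x within T)"
      by simp
    then show "((\<lambda>x. R x w) has_derivative R' x) (at x within T)"
      by (rule has_derivative_transform[OF x, rotated]) (simp add: eq)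
  next
    fix v assume v: "v \<in> V"
    have "C_k_on k V T (\<lambda>x. (R x w \<bullet> b) *\<^sub>R A' b x v)" for b
      by (rule C_k_on_scaleR[OF C_k_on_bounded_linear[OF bounded_linear_inner_left IH] A'C[OF v]])
    then have "C_k_on k V T (\<lambda>x. \<Sum>b\<in>Basis. (R x w \<bullet> b) *\<^sub>R A' b x v)"
      by (rule C_k_on_sum[OF finite_Basis])
    then have "C_k_on k V T (\<lambda>x. ((\<Sum>b\<in>Basis. (R x w \<bullet> b) *\<^sub>R A' b x v) \<bullet> e) *\<^sub>R R x e)" for e
      by (rule C_k_on_scaleR[OF C_k_on_bounded_linear[OF bounded_linear_inner_left] IH])
    then have "C_k_on k V T (\<lambda>x. \<Sum>e\<in>Basis. ((\<Sum>b\<in>Basis. (R x w \<bullet> b) *\<^sub>R A' b x v) \<bullet> e) *\<^sub>R R x e)"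
      by (rule C_k_on_sum[OF finite_Basis])
    then show "C_k_on k V T (\<lambda>x. R' x v)"
      unfolding R'_def by (rule C_k_on_bounded_linear[OF bounded_linear_minus[OF bounded_linear_ident]])
  qed
qed

text \<open>
The inverse function theorem supplies a differentiable local inverse \<open>g\<close> with derivative \<open>(f' \<circ> g)\<inverse>\<close>. If \<open>g\<close> is
\<open>C\<^sup>k\<close>, so is \<open>f' \<circ> g\<close> and hence its inverse, which makes \<open>g\<close> of class \<open>C\<^sup>k\<^sup>+\<^sup>1\<close>.
\<close>

lemma smooth_local_inverse_UNIV:
  fixes f :: "'e::euclidean_space \<Rightarrow> 'e"
  assumes S: "open S" "x0 \<in> S" and f: "smooth_on UNIV S f"
    and der: "(f has_derivative (\<lambda>v. v)) (at x0)"
  obtains U V g where "open U" "x0 \<in> U" "U \<subseteq> S" "open V" "homeomorphism U V f g" "smooth_on UNIV V g"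
proof -
  have "openin (top_of_set UNIV) S"
    using S by simp
  from smooth_on_derivative[OF subspace_UNIV this f] obtain f' where
    f'0: "\<And>x. x \<in> S \<Longrightarrow> (f has_derivative f' x) (at x within S)"
    and f'C: "\<And>v. smooth_on UNIV S (\<lambda>x. f' x v)"
    by (metis UNIV_I)
  have f': "(f has_derivative f' x) (at x)" if "x \<in> S" for x
    using f'0[OF that] at_within_open[OF that S(1)] by simp
  define F where "F x = Blinfun (f' x)" for x
  have F: "blinfun_apply (F x) = f' x" if "x \<in> S" for x
    using f'[OF that] by (simp add: F_def bounded_linear_Blinfun_apply has_derivative_bounded_linear)
  have "continuous_on S (\<lambda>x. F x v)" for v
  proof -
    have "C_k_on 0 UNIV S (\<lambda>x. f' x v)"
      using f'C unfolding smooth_on_def by blast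
    then show ?thesis
      using F by (simp cong: continuous_on_cong)
  qed
  then have "continuous_on S F"
    by (intro continuous_on_blinfun_componentwise)
  moreover have "id_blinfun o\<^sub>L F x0 = id_blinfun"
    using has_derivative_unique[OF f'[OF S(2)] der] F[OF S(2)] by (intro blinfun_eqI) simp
  moreover have "(f has_derivative blinfun_apply (F x)) (at x)" if "x \<in> S" for x
    using f'[OF that] F[OF that] by simp
  ultimately obtain U V g g' where
    UV: "open U" "U \<subseteq> S" "x0 \<in> U" "open V" "homeomorphism U V f g"
    and g: "\<And>y. y \<in> V \<Longrightarrow> (g has_derivative g' y) (at y)"
    "\<And>y. y \<in> V \<Longrightarrow> g' y = inv (blinfun_apply (F (g y)))"
    "\<And>y. y \<in> V \<Longrightarrow> bij (blinfun_apply (F (g y)))"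
    using inverse_function_theorem[OF S(1) _ _ S(2)] by metis
  have gS: "g y \<in> S" if "y \<in> V" for y
    using UV(2,5) that by (auto simp: homeomorphism_def)
  have "C_k_on k UNIV V g" for k
  proof (induction k)
    case 0
    then show ?case
      using UV(5) by (simp add: homeomorphism_def)
  next
    case (Suc k)
    show ?case
    proof (rule C_k_on_SucI[where f' = g'])
      show "(g has_derivative g' y) (at y within V)" if "y \<in> V" for y
        using g(1)[OF that] by (rule has_derivative_at_withinI)
      fix v :: 'e
      show "C_k_on k UNIV V (\<lambda>y. g' y v)"
      proof (rule linear_family_inverse_C_k[where A = "\<lambda>y. f' (g y)"])
        fix y u assume y: "y \<in> V"
        show "linear (f' (g y))"
          using f'[OF gS[OF y]] has_derivative_linear by blast
        show "linear (g' y)"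
          using g(1)[OF y] has_derivative_linear by blast
        show "g' y (f' (g y) u) = u"
          using g(2,3)[OF y] F[OF gS[OF y]] by (simp add: bij_is_inj)
        show "f' (g y) (g' y u) = u"
          using g(2,3)[OF y] F[OF gS[OF y]] by (simp add: bij_is_surj surj_f_inv_f)
      next
        fix u
        have "C_k_on k UNIV S (\<lambda>x. f' x u)"
          using f'C unfolding smooth_on_def by blast
        then show "C_k_on k UNIV V (\<lambda>y. f' (g y) u)"
          using Suc gS UV(4)
          by (intro C_k_on_compose[where f = "\<lambda>x. f' x u" and h = g and S = S and V = UNIV]) auto
      qed
    qed
  qed
  then have "smooth_on UNIV V g"
    by (simp add: smooth_on_def)
  then show thesis
    using that UV by blast
qed

text \<open>
To work in the whole space, \<open>f\<close> is precomposed with a linear projection \<open>P\<close> onto \<open>V\<close>, postcomposed with a linear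
left inverse \<open>B\<close> of its derivative, and completed by the identity on the kernel of \<open>P\<close>. The resulting map \<open>h\<close> has
derivative the identity, and \<open>h x - (x - P x)\<close> lies in \<open>V\<close>, so that points outside \<open>V\<close> have images outside \<open>V\<close>;
therefore the local inverse of \<open>h\<close> preserves \<open>V\<close>.
\<close>

lemma smooth_local_inverse:
  fixes f :: "'e::euclidean_space \<Rightarrow> 'f::euclidean_space"
  assumes V: "subspace V" and W: "subspace W" and S: "openin (top_of_set V) S" "x0 \<in> S"
    and f: "smooth_on V S f" "f ` S \<subseteq> W"
    and D: "(f has_derivative D) (at x0 within S)" "inj_on D V" "D ` V = W"
  obtains S' T g where "openin (top_of_set V) S'" "x0 \<in> S'" "S' \<subseteq> S" "openin (top_of_set W) T"
    "homeomorphism S' T f g" "smooth_on W T g"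
proof -
  have "linear D"
    using D(1) has_derivative_linear by blast
  then obtain B where B: "range B \<subseteq> V" "linear B" "\<And>v. v \<in> V \<Longrightarrow> B (D v) = v"
    using linear_exists_left_inverse_on[OF _ V D(2)] by blast
  have Binj: "y = z" if "y \<in> W" "z \<in> W" "B y = B z" for y z
    using that D(3) B(3) by (metis imageE)
  have "inj_on (\<lambda>x. x) V"
    by (simp add: inj_on_def)
  then obtain P where P: "range P \<subseteq> V" "linear P" "\<And>v. v \<in> V \<Longrightarrow> P v = v"
    using linear_exists_left_inverse_on[OF linear_ident V] by blast
  have SV: "S \<subseteq> V"
    using S openin_imp_subset by blast
  obtain U0 where U0: "open U0" "S = V \<inter> U0"
    using S by (auto simp: openin_open)
  define S1 where "S1 = P -` S"
  have "S1 = P -` U0"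
    using U0 P(1) by (auto simp: S1_def)
  then have S1: "open S1"
    using U0(1) P(2) by (simp add: open_vimage linear_continuous_on linear_conv_bounded_linear)
  have x0: "x0 \<in> V" "x0 \<in> S1"
    using S(2) SV P(3) by (auto simp: S1_def)
  define h where "h x = B (f (P x)) + (x - P x)" for x
  have hV: "h x = B (f x)" if "x \<in> V" for x
    using that P(3) by (simp add: h_def)
  have "C_k_on k UNIV S1 h" for k
  proof -
    have "C_k_on k V S f"
      using f(1) by (simp add: smooth_on_def)
    from C_k_on_compose[OF V subspace_UNIV _ _ SV this C_k_on_linear[OF P(2)]]
    have "C_k_on k UNIV S1 (\<lambda>x. f (P x))"
      using S1 by (auto simp: S1_def)
    then have "C_k_on k UNIV S1 (\<lambda>x. B (f (P x)))"
      using B(2) C_k_on_bounded_linear by (simp add: linear_conv_bounded_linear)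
    moreover have "C_k_on k UNIV S1 (\<lambda>x. x - P x)"
      by (rule C_k_on_linear[OF linear_compose_sub[OF linear_ident P(2)]])
    ultimately show ?thesis
      unfolding h_def by (rule C_k_on_add)
  qed
  then have "smooth_on UNIV S1 h"
    by (simp add: smooth_on_def)
  moreover have "(h has_derivative (\<lambda>v. v)) (at x0)"
  proof -
    have bl: "bounded_linear B" "bounded_linear P"
      using B(2) P(2) linear_conv_bounded_linear by blast+
    have P': "(P has_derivative P) (at x0 within S1)"
      using bounded_linear_imp_has_derivative[OF bl(2)] .
    have "(f has_derivative D) (at (P x0) within P ` S1)"
      using D(1) P(3)[OF x0(1)] has_derivative_subset[of f D x0 S "P ` S1"] by (auto simp: S1_def)
    from diff_chain_within[OF P' this]
    have "((\<lambda>x. f (P x)) has_derivative (\<lambda>v. D (P v))) (at x0 within S1)"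
      by (simp add: o_def)
    from has_derivative_add[OF bounded_linear.has_derivative[OF bl(1) this]
        has_derivative_diff[OF has_derivative_ident P']]
    have "(h has_derivative (\<lambda>v. B (D (P v)) + (v - P v))) (at x0 within S1)"
      by (simp add: h_def[abs_def])
    moreover have "(\<lambda>v. B (D (P v)) + (v - P v)) = (\<lambda>v. v)"
      using B(3) P(1) by (auto simp: fun_eq_iff)
    ultimately show ?thesis
      using at_within_open[OF x0(2) S1] by simp
  qed
  ultimately obtain U U' g where U: "open U" "x0 \<in> U" "U \<subseteq> S1" "open U'"
      "homeomorphism U U' h g" "smooth_on UNIV U' g"
    using smooth_local_inverse_UNIV[OF S1 x0(2)] by blast
  have g: "\<And>x. x \<in> U \<Longrightarrow> h x \<in> U' \<and> g (h x) = x" "\<And>y. y \<in> U' \<Longrightarrow> g y \<in> U \<and> h (g y) = y"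
    using U(5) by (auto simp: homeomorphism_def)
  define S' where "S' = U \<inter> V"
  define T where "T = {y \<in> W. B y \<in> U'}"
  have S': "openin (top_of_set V) S'" "x0 \<in> S'" "S' \<subseteq> S"
    using U x0 P(3) by (auto simp: S'_def S1_def openin_open)
  have contB: "continuous_on X B" for X
    using B(2) by (simp add: linear_continuous_on linear_conv_bounded_linear)
  have "T = W \<inter> B -` U'"
    by (auto simp: T_def)
  then have T: "openin (top_of_set W) T"
    using open_vimage[OF U(4) contB] by (auto simp: openin_open)
  have smooth: "smooth_on W T (\<lambda>y. g (B y))"
    unfolding smooth_on_def
  proof
    fix k
    have "C_k_on k UNIV U' g"
      using U(6) by (simp add: smooth_on_def)
    from C_k_on_compose[OF subspace_UNIV W T _ _ this C_k_on_linear[OF B(2)]]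
    show "C_k_on k W T (\<lambda>y. g (B y))"
      by (auto simp: T_def)
  qed
  have fT: "f x \<in> T \<and> g (B (f x)) = x" if "x \<in> S'" for x
    using that g(1)[of x] hV[of x] f(2) S'(3) by (auto simp: S'_def T_def)
  have gS': "g (B y) \<in> S' \<and> f (g (B y)) = y" if y: "y \<in> T" for y
  proof -
    define x where "x = g (B y)"
    have x: "x \<in> U" "h x = B y"
      using y g(2) by (auto simp: T_def x_def)
    have "P x \<in> V" "B z \<in> V" for z
      using P(1) B(1) by auto
    then have "B y - B (f (P x)) + P x \<in> V"
      using V by (simp add: subspace_add subspace_diff)
    moreover have "x = B y - B (f (P x)) + P x"
      using x(2) by (simp add: h_def algebra_simps)
    ultimately have "x \<in> V"
      by simp
    then have "x \<in> S'"
      using x by (simp add: S'_def)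
    moreover have "B (f x) = B y"
      using x(2) hV[OF \<open>x \<in> V\<close>] by simp
    moreover have "f x \<in> W" "y \<in> W"
      using \<open>x \<in> S'\<close> S'(3) f(2) y by (auto simp: T_def)
    ultimately show ?thesis
      using Binj x_def by blast
  qed
  have "homeomorphism S' T f (\<lambda>y. g (B y))"
  proof
    have "C_k_on 0 V S f" "C_k_on 0 W T (\<lambda>y. g (B y))"
      using f(1) smooth unfolding smooth_on_def by blast+
    then show "continuous_on S' f" "continuous_on T (\<lambda>y. g (B y))"
      using S'(3) continuous_on_subset by auto
  qed (use fT gS' in auto)
  then show thesis
    using that S' T smooth by blast
qed

section \<open>Charts and smooth maps\<close>

lemma smooth_manifoldD:
  assumes "smooth_manifold M"
  shows "Hausdorff_space (topo M)" "second_countable (topo M)" "subspace (model M)"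
  using assms by (simp_all add: smooth_manifold_def)

lemma chart_exists:
  assumes "smooth_manifold M" "p \<in> pts M"
  obtains W \<phi> where "(W, \<phi>) \<in> charts M" "p \<in> W"
proof -
  have "p \<in> (\<Union>(W, \<phi>)\<in>charts M. W)"
    using assms by (simp add: smooth_manifold_def)
  then show thesis
    using that by auto
qed

lemma
  assumes "smooth_manifold M" "(W, \<phi>) \<in> charts M"
  shows chart_open: "openin (topo M) W"
    and chart_image_open: "openin (top_of_set (model M)) (\<phi> ` W)"
    and chart_homeomorphic: "homeomorphic_map (subtopology (topo M) W) (top_of_set (\<phi> ` W)) \<phi>"
  using assms unfolding smooth_manifold_def by fast+

lemma chart_transition:
  assumes "smooth_manifold M" "(W, \<phi>) \<in> charts M" "(W', \<phi>') \<in> charts M"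
  shows "smooth_on (model M) (\<phi> ` (W \<inter> W')) (\<lambda>y. \<phi>' (inv_into W \<phi> y))"
  using assms unfolding smooth_manifold_def o_def by fast

lemma chart_subset: "smooth_manifold M \<Longrightarrow> (W, \<phi>) \<in> charts M \<Longrightarrow> W \<subseteq> pts M"
  using chart_open openin_subset by blast

lemma chart_subtopology_topspace:
  "smooth_manifold M \<Longrightarrow> (W, \<phi>) \<in> charts M \<Longrightarrow> topspace (subtopology (topo M) W) = W"
  using chart_subset[of M W \<phi>] by (simp add: Int_absorb1)

lemma chart_inj: "smooth_manifold M \<Longrightarrow> (W, \<phi>) \<in> charts M \<Longrightarrow> inj_on \<phi> W"
  using homeomorphic_imp_injective_map[OF chart_homeomorphic] chart_subtopology_topspace by metis

lemma chart_open_image: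
  assumes M: "smooth_manifold M" and W: "(W, \<phi>) \<in> charts M" and O: "openin (topo M) Q" "Q \<subseteq> W"
  shows "openin (top_of_set (model M)) (\<phi> ` Q)"
proof -
  have "openin (subtopology (topo M) W) Q"
    using O openin_open_subtopology[OF chart_open[OF M W]] by blast
  then have "openin (top_of_set (\<phi> ` W)) (\<phi> ` Q)"
    using homeomorphic_imp_open_map[OF chart_homeomorphic[OF M W]] by (simp add: open_map_def)
  then show ?thesis
    using chart_image_open[OF M W] openin_trans by blast
qed

lemma chart_continuous:
  "smooth_manifold M \<Longrightarrow> (W, \<phi>) \<in> charts M \<Longrightarrow>
    continuous_map (subtopology (topo M) W) (top_of_set (\<phi> ` W)) \<phi>"
  using homeomorphic_imp_continuous_map[OF chart_homeomorphic] .

lemma chart_inverse_continuous: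
  assumes M: "smooth_manifold M" and W: "(W, \<phi>) \<in> charts M"
  shows "continuous_map (top_of_set (\<phi> ` W)) (subtopology (topo M) W) (inv_into W \<phi>)"
proof -
  obtain g where g: "homeomorphic_maps (subtopology (topo M) W) (top_of_set (\<phi> ` W)) \<phi> g"
    using chart_homeomorphic[OF M W] homeomorphic_map_maps by blast
  then have "continuous_map (top_of_set (\<phi> ` W)) (subtopology (topo M) W) g"
    and gf: "\<forall>x\<in>W. g (\<phi> x) = x"
    using chart_subtopology_topspace[OF M W] by (auto simp: homeomorphic_maps_def)
  then show ?thesis
    using chart_inj[OF M W] by (elim continuous_map_eq) auto
qed

lemma inv_into_Int:
  assumes "inj_on f A" "y \<in> f ` (A \<inter> B)"
  shows "inv_into (A \<inter> B) f y = inv_into A f y"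
proof -
  obtain x where x: "x \<in> A" "x \<in> B" "y = f x"
    using assms(2) by blast
  have "inj_on f (A \<inter> B)"
    using assms(1) inj_on_subset by blast
  then show ?thesis
    using x assms(1) by (simp add: inv_into_f_f)
qed

lemma smooth_mapI:
  assumes "continuous_map (topo M) (topo N) f"
    and "\<And>W \<phi> W' \<psi>. (W, \<phi>) \<in> charts M \<Longrightarrow> (W', \<psi>) \<in> charts N \<Longrightarrow>
      smooth_on (model M) (\<phi> ` {x \<in> W. f x \<in> W'}) (\<lambda>y. \<psi> (f (inv_into W \<phi> y)))"
  shows "smooth_map M N f"
  unfolding smooth_map_def o_def using assms by auto

lemma smooth_map_continuous: "smooth_map M N f \<Longrightarrow> continuous_map (topo M) (topo N) f"
  by (simp add: smooth_map_def)

lemma smooth_map_in: "smooth_map M N f \<Longrightarrow> x \<in> pts M \<Longrightarrow> f x \<in> pts N"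
  using smooth_map_continuous continuous_map_image_subset_topspace by fastforce

lemma smooth_map_in_charts:
  assumes "smooth_map M N f" "(W, \<phi>) \<in> charts M" "(W', \<psi>) \<in> charts N"
  shows "smooth_on (model M) (\<phi> ` {x \<in> W. f x \<in> W'}) (\<lambda>y. \<psi> (f (inv_into W \<phi> y)))"
  using assms unfolding smooth_map_def o_def by fast

lemma smooth_map_chart_domain_open:
  assumes "smooth_manifold M" "smooth_manifold N" "smooth_map M N f"
    and "(W, \<phi>) \<in> charts M" "(W', \<psi>) \<in> charts N"
  shows "openin (top_of_set (model M)) (\<phi> ` {x \<in> W. f x \<in> W'})"
  using openin_continuous_map_preimage_gen[OF smooth_map_continuous[OF assms(3)]
      chart_open[OF assms(1,4)] chart_open[OF assms(2,5)]]
  by (rule chart_open_image[OF assms(1,4)]) auto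

lemma smooth_map_cong:
  assumes M: "smooth_manifold M" and f: "smooth_map M N f" and eq: "\<And>x. x \<in> pts M \<Longrightarrow> f x = g x"
  shows "smooth_map M N g"
proof (rule smooth_mapI)
  show "continuous_map (topo M) (topo N) g"
    using smooth_map_continuous[OF f] eq by (rule continuous_map_eq)
  fix W \<phi> W' \<psi> assume W: "(W, \<phi>) \<in> charts M" "(W', \<psi>) \<in> charts N"
  have eqW: "f x = g x" if "x \<in> W" for x
    using chart_subset[OF M W(1)] eq that by blast
  then have eq: "{x \<in> W. g x \<in> W'} = {x \<in> W. f x \<in> W'}"
    by auto
  show "smooth_on (model M) (\<phi> ` {x \<in> W. g x \<in> W'}) (\<lambda>y. \<psi> (g (inv_into W \<phi> y)))"
    unfolding eq by (rule smooth_on_cong[OF smooth_map_in_charts[OF f W]])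
      (auto simp: chart_inj[OF M W(1)] eqW)
qed

lemma smooth_map_ident:
  assumes "smooth_manifold M"
  shows "smooth_map M M (\<lambda>x. x)"
proof (rule smooth_mapI)
  show "continuous_map (topo M) (topo M) (\<lambda>x. x)"
    by (simp add: continuous_map_id[unfolded id_def])
  fix W \<phi> W' \<psi> assume W: "(W, \<phi>) \<in> charts M" "(W', \<psi>) \<in> charts M"
  have "{x \<in> W. x \<in> W'} = W \<inter> W'"
    by auto
  then show "smooth_on (model M) (\<phi> ` {x \<in> W. x \<in> W'}) (\<lambda>y. \<psi> (inv_into W \<phi> y))"
    using chart_transition[OF assms W] by simp
qed

lemma smooth_map_const:
  assumes "c \<in> pts N"
  shows "smooth_map M N (\<lambda>_. c)"
  using assms by (intro smooth_mapI smooth_on_const) simp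

text \<open>
Near each point, a chart of the middle manifold factors the coordinate expression of the composite into the
coordinate expressions of the two maps; smoothness is local, so this suffices.
\<close>

lemma smooth_map_compose:
  assumes M: "smooth_manifold M" and N: "smooth_manifold N" and P: "smooth_manifold P"
    and f: "smooth_map M N f" and g: "smooth_map N P g"
  shows "smooth_map M P (\<lambda>x. g (f x))"
proof (rule smooth_mapI)
  have gf: "continuous_map (topo M) (topo P) (\<lambda>x. g (f x))"
    using continuous_map_compose[OF smooth_map_continuous[OF f] smooth_map_continuous[OF g]]
    by (simp add: o_def)
  then show "continuous_map (topo M) (topo P) (\<lambda>x. g (f x))" .
  fix W \<phi> W' \<psi> assume W: "(W, \<phi>) \<in> charts M" "(W', \<psi>) \<in> charts P"
  show "smooth_on (model M) (\<phi> ` {x \<in> W. g (f x) \<in> W'}) (\<lambda>y. \<psi> (g (f (inv_into W \<phi> y))))"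
  proof (rule smooth_on_local)
    show "subspace (model M)"
      by (rule smooth_manifoldD[OF M])
    fix y assume "y \<in> \<phi> ` {x \<in> W. g (f x) \<in> W'}"
    then obtain x where x: "x \<in> W" "g (f x) \<in> W'" "y = \<phi> x"
      by blast
    have "f x \<in> pts N"
      using smooth_map_in[OF f] chart_subset[OF M W(1)] x(1) by blast
    then obtain Y \<kappa> where Y: "(Y, \<kappa>) \<in> charts N" "f x \<in> Y"
      by (rule chart_exists[OF N])
    define Q where "Q = {z \<in> {x \<in> W. f x \<in> Y}. g (f z) \<in> W'}"
    have "openin (topo M) Q"
      unfolding Q_def
      by (intro openin_continuous_map_preimage_gen[OF gf _ chart_open[OF P W(2)]]
          openin_continuous_map_preimage_gen[OF smooth_map_continuous[OF f] chart_open[OF M W(1)]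
            chart_open[OF N Y(1)]])
    then have Qopen: "openin (top_of_set (model M)) (\<phi> ` Q)"
      by (rule chart_open_image[OF M W(1)]) (auto simp: Q_def)
    have inv: "inv_into W \<phi> (\<phi> z) = z" if "z \<in> Q" for z
      using that chart_inj[OF M W(1)] by (simp add: Q_def)
    have invN: "inv_into Y \<kappa> (\<kappa> z) = z" if "z \<in> Y" for z
      using that chart_inj[OF N Y(1)] by simp
    have "smooth_on (model M) (\<phi> ` Q)
      (\<lambda>y. (\<lambda>z. \<psi> (g (inv_into Y \<kappa> z))) ((\<lambda>y. \<kappa> (f (inv_into W \<phi> y))) y))"
    proof (rule smooth_on_compose[OF smooth_manifoldD(3)[OF N] smooth_manifoldD(3)[OF M] Qopen])
      show "smooth_on (model N) (\<kappa> ` {x \<in> Y. g x \<in> W'}) (\<lambda>z. \<psi> (g (inv_into Y \<kappa> z)))"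
        by (rule smooth_map_in_charts[OF g Y(1) W(2)])
      show "smooth_on (model M) (\<phi> ` Q) (\<lambda>y. \<kappa> (f (inv_into W \<phi> y)))"
        by (rule smooth_on_subset[OF smooth_map_in_charts[OF f W(1) Y(1)]]) (auto simp: Q_def)
      show "(\<lambda>y. \<kappa> (f (inv_into W \<phi> y))) ` \<phi> ` Q \<subseteq> \<kappa> ` {x \<in> Y. g x \<in> W'}"
        using inv by (auto simp: Q_def)
      show "\<kappa> ` {x \<in> Y. g x \<in> W'} \<subseteq> model N"
        using smooth_map_chart_domain_open[OF N P g Y(1) W(2)] openin_imp_subset by blast
    qed
    then have "smooth_on (model M) (\<phi> ` Q) (\<lambda>y. \<psi> (g (f (inv_into W \<phi> y))))"
      by (rule smooth_on_cong) (use inv invN in \<open>auto simp: Q_def\<close>)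
    moreover have "y \<in> \<phi> ` Q" "\<phi> ` Q \<subseteq> \<phi> ` {x \<in> W. g (f x) \<in> W'}"
      using x Y(2) by (auto simp: Q_def)
    ultimately show "\<exists>T. openin (top_of_set (model M)) T \<and> y \<in> T \<and>
        T \<subseteq> \<phi> ` {x \<in> W. g (f x) \<in> W'} \<and> smooth_on (model M) T (\<lambda>y. \<psi> (g (f (inv_into W \<phi> y))))"
      using Qopen by blast
  qed
qed

section \<open>Open submanifolds and products\<close>

lemma topo_open_submanifold [simp]: "topo (open_submanifold M U) = subtopology (topo M) U"
  and model_open_submanifold [simp]: "model (open_submanifold M U) = model M"
  by (simp_all add: open_submanifold_def)

lemma charts_open_submanifold:
  "(Y, \<phi>) \<in> charts (open_submanifold M U) \<longleftrightarrow> (\<exists>W. Y = W \<inter> U \<and> (W, \<phi>) \<in> charts M)"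
  by (auto simp: open_submanifold_def)

lemma pts_open_submanifold: "openin (topo M) U \<Longrightarrow> pts (open_submanifold M U) = U"
  using openin_subset[of "topo M" U] by (simp add: Int_absorb1)

lemma in_chart_domains: "x \<in> (\<Union>(W, \<phi>)\<in>A. W) \<longleftrightarrow> (\<exists>W \<phi>. (W, \<phi>) \<in> A \<and> x \<in> W)"
  by auto

lemma smooth_manifold_open_submanifold:
  assumes M: "smooth_manifold M" and U: "openin (topo M) U"
  shows "smooth_manifold (open_submanifold M U)"
proof -
  let ?MU = "open_submanifold M U"
  have "(\<Union>(W, \<phi>)\<in>charts ?MU. W) = (\<Union>(W, \<phi>)\<in>charts M. W) \<inter> U"
    by (rule set_eqI, unfold Int_iff in_chart_domains charts_open_submanifold) blast
  also have "\<dots> = pts ?MU"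
    using M by (simp add: smooth_manifold_def)
  finally have cover: "(\<Union>(W, \<phi>)\<in>charts ?MU. W) = pts ?MU" .
  have chart: "openin (topo ?MU) (W \<inter> U) \<and> openin (top_of_set (model ?MU)) (\<phi> ` (W \<inter> U)) \<and>
      homeomorphic_map (subtopology (topo ?MU) (W \<inter> U)) (top_of_set (\<phi> ` (W \<inter> U))) \<phi>"
    if W: "(W, \<phi>) \<in> charts M" for W \<phi>
  proof (intro conjI)
    have WU: "openin (topo M) (W \<inter> U)"
      using chart_open[OF M W] U by blast
    then show "openin (topo ?MU) (W \<inter> U)"
      using U by (simp add: openin_open_subtopology)
    show "openin (top_of_set (model ?MU)) (\<phi> ` (W \<inter> U))"
      using chart_open_image[OF M W WU] by simp
    have "homeomorphic_map (subtopology (subtopology (topo M) W) (W \<inter> U))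
        (subtopology (top_of_set (\<phi> ` W)) (\<phi> ` (W \<inter> U))) \<phi>"
      using chart_subtopology_topspace[OF M W]
      by (intro homeomorphic_map_subtopologies[OF chart_homeomorphic[OF M W]]) auto
    moreover have "W \<inter> (W \<inter> U) = W \<inter> U" "U \<inter> (W \<inter> U) = W \<inter> U"
      "\<phi> ` W \<inter> \<phi> ` (W \<inter> U) = \<phi> ` (W \<inter> U)"
      by auto
    ultimately show "homeomorphic_map (subtopology (topo ?MU) (W \<inter> U)) (top_of_set (\<phi> ` (W \<inter> U))) \<phi>"
      by (simp add: subtopology_subtopology)
  qed
  have transition: "smooth_on (model ?MU) (\<phi> ` (W \<inter> U \<inter> (W' \<inter> U))) (\<phi>' \<circ> inv_into (W \<inter> U) \<phi>)"
    if W: "(W, \<phi>) \<in> charts M" "(W', \<phi>') \<in> charts M" for W \<phi> W' \<phi>'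
  proof -
    have "smooth_on (model M) (\<phi> ` (W \<inter> U \<inter> (W' \<inter> U))) (\<lambda>y. \<phi>' (inv_into W \<phi> y))"
      by (rule smooth_on_subset[OF chart_transition[OF M W]]) auto
    then have "smooth_on (model M) (\<phi> ` (W \<inter> U \<inter> (W' \<inter> U))) (\<lambda>y. \<phi>' (inv_into (W \<inter> U) \<phi> y))"
      by (rule smooth_on_cong) (use inv_into_Int[OF chart_inj[OF M W(1)]] in auto)
    then show ?thesis
      by (simp add: o_def)
  qed
  show ?thesis
    unfolding smooth_manifold_def
  proof (intro conjI cover)
    show "Hausdorff_space (topo ?MU)" "second_countable (topo ?MU)" "subspace (model ?MU)"
      using smooth_manifoldD[OF M] by (simp_all add: Hausdorff_space_subtopology second_countable_subtopology)
    show "\<forall>(Y, \<phi>)\<in>charts ?MU. openin (topo ?MU) Y \<and> openin (top_of_set (model ?MU)) (\<phi> ` Y) \<and>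
        homeomorphic_map (subtopology (topo ?MU) Y) (top_of_set (\<phi> ` Y)) \<phi>"
      using chart unfolding Ball_def split_paired_All prod.case charts_open_submanifold by blast
    show "\<forall>(Y, \<phi>)\<in>charts ?MU. \<forall>(Y', \<phi>')\<in>charts ?MU.
        smooth_on (model ?MU) (\<phi> ` (Y \<inter> Y')) (\<phi>' \<circ> inv_into Y \<phi>)"
      using transition unfolding Ball_def split_paired_All prod.case charts_open_submanifold by blast
  qed
qed

lemma smooth_map_open_submanifold:
  assumes M: "smooth_manifold M" and f: "smooth_map M N f"
    and U: "openin (topo M) U" and V: "openin (topo N) V" "f ` U \<subseteq> V"
  shows "smooth_map (open_submanifold M U) (open_submanifold N V) f"
proof (rule smooth_mapI)
  have "continuous_map (subtopology (topo M) U) (topo N) f"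
    using smooth_map_continuous[OF f] continuous_map_from_subtopology by blast
  then show "continuous_map (topo (open_submanifold M U)) (topo (open_submanifold N V)) f"
    using V by (auto intro!: continuous_map_into_subtopology)
  fix Y \<phi> Y' \<psi>
  assume "(Y, \<phi>) \<in> charts (open_submanifold M U)" "(Y', \<psi>) \<in> charts (open_submanifold N V)"
  then obtain W W' where Y: "Y = W \<inter> U" "Y' = W' \<inter> V" and W: "(W, \<phi>) \<in> charts M" "(W', \<psi>) \<in> charts N"
    by (auto simp: charts_open_submanifold)
  have "smooth_on (model M) (\<phi> ` {x \<in> Y. f x \<in> Y'}) (\<lambda>y. \<psi> (f (inv_into W \<phi> y)))"
    by (rule smooth_on_subset[OF smooth_map_in_charts[OF f W]]) (auto simp: Y)
  then have "smooth_on (model M) (\<phi> ` {x \<in> Y. f x \<in> Y'}) (\<lambda>y. \<psi> (f (inv_into Y \<phi> y)))"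
    by (rule smooth_on_cong) (use inv_into_Int[OF chart_inj[OF M W(1)], of _ U] in \<open>auto simp: Y\<close>)
  then show "smooth_on (model (open_submanifold M U)) (\<phi> ` {x \<in> Y. f x \<in> Y'})
      (\<lambda>y. \<psi> (f (inv_into Y \<phi> y)))"
    by simp
qed

lemma open_submanifold_pts:
  assumes "smooth_manifold M"
  shows "open_submanifold M (pts M) = M"
proof -
  have "{(W \<inter> pts M, \<phi>) | W \<phi>. (W, \<phi>) \<in> charts M} = charts M"
    using chart_subset[OF assms] by (force simp: Int_absorb2)
  then show ?thesis
    by (simp add: open_submanifold_def)
qed

lemma smooth_map_inclusion:
  assumes "smooth_manifold M" "openin (topo M) U"
  shows "smooth_map (open_submanifold M U) M (\<lambda>x. x)"
  using smooth_map_open_submanifold[OF assms(1) smooth_map_ident[OF assms(1)] assms(2), of "pts M"]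
    open_submanifold_pts[OF assms(1)] openin_subset[OF assms(2)] by auto

lemma smooth_map_extend_codomain:
  assumes "smooth_manifold M" "smooth_manifold N" "smooth_map M (open_submanifold N V) f"
    "openin (topo N) V"
  shows "smooth_map M N f"
  using smooth_map_compose[OF assms(1) smooth_manifold_open_submanifold[OF assms(2,4)] assms(2,3)
      smooth_map_inclusion[OF assms(2,4)]] .

lemma euclidean_manifold_simps [simp]:
  "topo (euclidean_manifold V) = top_of_set V" "model (euclidean_manifold V) = V"
  "charts (euclidean_manifold V) = {(V, \<lambda>x. x)}"
  by (simp_all add: euclidean_manifold_def)

lemma second_countable_euclidean:
  "second_countable (euclidean :: 'a::second_countable_topology topology)"
proof -
  obtain \<B> :: "'a set set" where "countable \<B>" and basis: "topological_basis \<B>"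
    using ex_countable_basis by blast
  moreover have "\<forall>V\<in>\<B>. openin euclidean V"
    using topological_basis_open[OF basis] by simp
  moreover have "\<exists>V\<in>\<B>. x \<in> V \<and> V \<subseteq> U" if "openin euclidean U \<and> x \<in> U" for U :: "'a set" and x
    using topological_basisE[OF basis, of U x] that by (metis open_openin)
  ultimately show ?thesis
    unfolding second_countable_def by blast
qed

lemma inv_into_ident [simp]: "y \<in> A \<Longrightarrow> inv_into A (\<lambda>x. x) y = y"
  using inv_into_f_f[of "\<lambda>x. x" A y] by simp

lemma smooth_manifold_euclidean:
  assumes "subspace V"
  shows "smooth_manifold (euclidean_manifold V)"
proof -
  have "homeomorphic_map (top_of_set V) (top_of_set V) (\<lambda>x. x)"
    using homeomorphic_map_id[of "top_of_set V" "top_of_set V"] by (simp add: id_def)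
  moreover have "smooth_on V V (inv_into V (\<lambda>x. x))"
    by (rule smooth_on_cong[OF smooth_on_ident]) simp
  ultimately show ?thesis
    using assms by (simp add: smooth_manifold_def Hausdorff_space_subtopology
        second_countable_subtopology second_countable_euclidean subtopology_subtopology o_def)
qed

lemma smooth_map_between_euclidean:
  assumes "smooth_on V S f" "f ` S \<subseteq> T" "S \<subseteq> V" "T \<subseteq> W"
  shows "smooth_map (open_submanifold (euclidean_manifold V) S) (open_submanifold (euclidean_manifold W) T) f"
proof (rule smooth_mapI)
  have SV: "V \<inter> S = S" "W \<inter> T = T"
    using assms(3,4) by auto
  show "continuous_map (topo (open_submanifold (euclidean_manifold V) S))
      (topo (open_submanifold (euclidean_manifold W) T)) f"
    using smooth_on_imp_continuous_on[OF assms(1)] assms(2)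
    by (auto simp: subtopology_subtopology SV)
  fix Y \<phi> Y' \<psi>
  assume "(Y, \<phi>) \<in> charts (open_submanifold (euclidean_manifold V) S)"
    "(Y', \<psi>) \<in> charts (open_submanifold (euclidean_manifold W) T)"
  then have *: "Y = S" "Y' = T" "\<phi> = (\<lambda>x. x)" "\<psi> = (\<lambda>x. x)"
    using SV by (auto simp: charts_open_submanifold)
  have "smooth_on V S (\<lambda>y. f (inv_into S (\<lambda>x. x) y))"
    by (rule smooth_on_cong[OF assms(1)]) simp
  then show "smooth_on (model (open_submanifold (euclidean_manifold V) S)) (\<phi> ` {x \<in> Y. f x \<in> Y'})
      (\<lambda>y. \<psi> (f (inv_into Y \<phi> y)))"
    unfolding * by (simp add: smooth_on_subset)
qed

lemma smooth_map_chart: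
  assumes M: "smooth_manifold M" and W: "(W, \<phi>) \<in> charts M"
  shows "smooth_map (open_submanifold M W) (open_submanifold (euclidean_manifold (model M)) (\<phi> ` W)) \<phi>"
proof (rule smooth_mapI)
  have sub: "\<phi> ` W \<subseteq> model M"
    using chart_image_open[OF M W] openin_imp_subset by blast
  then show "continuous_map (topo (open_submanifold M W))
      (topo (open_submanifold (euclidean_manifold (model M)) (\<phi> ` W))) \<phi>"
    using chart_continuous[OF M W] by (simp add: subtopology_subtopology Int_absorb1)
  fix Y \<kappa> Y' \<psi>
  assume "(Y, \<kappa>) \<in> charts (open_submanifold M W)"
    "(Y', \<psi>) \<in> charts (open_submanifold (euclidean_manifold (model M)) (\<phi> ` W))"
  then obtain Z where Z: "(Z, \<kappa>) \<in> charts M" and *: "Y = Z \<inter> W" "Y' = \<phi> ` W" "\<psi> = (\<lambda>x. x)"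
    using sub by (auto simp: charts_open_submanifold)
  have "smooth_on (model M) (\<kappa> ` (Z \<inter> W)) (\<lambda>y. \<phi> (inv_into (Z \<inter> W) \<kappa> y))"
    by (rule smooth_on_cong[OF chart_transition[OF M Z W]])
      (simp add: inv_into_Int[OF chart_inj[OF M Z]])
  then show "smooth_on (model (open_submanifold M W)) (\<kappa> ` {x \<in> Y. \<phi> x \<in> Y'})
      (\<lambda>y. \<psi> (\<phi> (inv_into Y \<kappa> y)))"
    unfolding * model_open_submanifold by (rule smooth_on_subset) auto
qed

lemma smooth_map_chart_inverse:
  assumes M: "smooth_manifold M" and W: "(W, \<phi>) \<in> charts M"
  shows "smooth_map (open_submanifold (euclidean_manifold (model M)) (\<phi> ` W)) (open_submanifold M W)
    (inv_into W \<phi>)"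
proof (rule smooth_mapI)
  have sub: "\<phi> ` W \<subseteq> model M"
    using chart_image_open[OF M W] openin_imp_subset by blast
  then show "continuous_map (topo (open_submanifold (euclidean_manifold (model M)) (\<phi> ` W)))
      (topo (open_submanifold M W)) (inv_into W \<phi>)"
    using chart_inverse_continuous[OF M W] by (simp add: subtopology_subtopology Int_absorb1)
  fix Y \<kappa> Y' \<psi>
  assume "(Y, \<kappa>) \<in> charts (open_submanifold (euclidean_manifold (model M)) (\<phi> ` W))"
    "(Y', \<psi>) \<in> charts (open_submanifold M W)"
  then obtain Z where Z: "(Z, \<psi>) \<in> charts M" and *: "Y = \<phi> ` W" "Y' = Z \<inter> W" "\<kappa> = (\<lambda>x. x)"
    using sub by (auto simp: charts_open_submanifold)
  have eq: "{y \<in> \<phi> ` W. inv_into W \<phi> y \<in> Z \<inter> W} = \<phi> ` (W \<inter> Z)"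
    using chart_inj[OF M W] by auto
  have "smooth_on (model M) (\<phi> ` (W \<inter> Z)) (\<lambda>y. \<psi> (inv_into W \<phi> (inv_into (\<phi> ` W) (\<lambda>x. x) y)))"
    by (rule smooth_on_cong[OF chart_transition[OF M W Z]]) auto
  then show "smooth_on (model (open_submanifold (euclidean_manifold (model M)) (\<phi> ` W)))
      (\<kappa> ` {x \<in> Y. inv_into W \<phi> x \<in> Y'}) (\<lambda>y. \<psi> (inv_into W \<phi> (inv_into Y \<kappa> y)))"
    unfolding * eq by simp
qed

lemma product_manifold_simps [simp]:
  "topo (product_manifold M N) = prod_topology (topo M) (topo N)"
  "model (product_manifold M N) = model M \<times> model N"
  by (simp_all add: product_manifold_def)

lemma charts_product_manifold:
  "(Y, \<phi>) \<in> charts (product_manifold M N) \<longleftrightarrow>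
    (\<exists>W \<psi> W' \<psi>'. Y = W \<times> W' \<and> \<phi> = map_prod \<psi> \<psi>' \<and> (W, \<psi>) \<in> charts M \<and> (W', \<psi>') \<in> charts N)"
  by (auto simp: product_manifold_def)

text \<open>
The two sides are equal as records, not merely diffeomorphic. Hence a pair of maps into open subsets of Euclidean
spaces can be fed into a smooth map defined on an open subset of the product space.
\<close>

lemma product_open_euclidean:
  "product_manifold (open_submanifold (euclidean_manifold V) S) (open_submanifold (euclidean_manifold W) T) =
    open_submanifold (euclidean_manifold (V \<times> W)) (S \<times> T)"
  by (auto simp: product_manifold_def open_submanifold_def euclidean_manifold_def
      subtopology_subtopology Times_Int_Times map_prod_def)

lemma inv_into_map_prod:
  assumes "inj_on \<phi> W" "inj_on \<psi> W'" "y \<in> \<phi> ` W" "z \<in> \<psi> ` W'"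
  shows "inv_into (W \<times> W') (map_prod \<phi> \<psi>) (y, z) = (inv_into W \<phi> y, inv_into W' \<psi> z)"
proof -
  obtain a b where ab: "a \<in> W" "b \<in> W'" "y = \<phi> a" "z = \<psi> b"
    using assms by blast
  have "inj_on (map_prod \<phi> \<psi>) (W \<times> W')"
    using assms(1,2) by (rule map_prod_inj_on)
  from inv_into_f_f[OF this, of "(a, b)"] show ?thesis
    using ab assms(1,2) by simp
qed

lemma second_countable_prod_topology:
  assumes "second_countable X" "second_countable Y"
  shows "second_countable (prod_topology X Y)"
proof -
  obtain \<B> \<C> where \<B>: "countable \<B>" "\<And>V. V \<in> \<B> \<Longrightarrow> openin X V"
      "\<And>U x. openin X U \<Longrightarrow> x \<in> U \<Longrightarrow> \<exists>V\<in>\<B>. x \<in> V \<and> V \<subseteq> U"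
    and \<C>: "countable \<C>" "\<And>V. V \<in> \<C> \<Longrightarrow> openin Y V"
      "\<And>U x. openin Y U \<Longrightarrow> x \<in> U \<Longrightarrow> \<exists>V\<in>\<C>. x \<in> V \<and> V \<subseteq> U"
    using assms unfolding second_countable_def by metis
  let ?\<D> = "(\<lambda>(U, V). U \<times> V) ` (\<B> \<times> \<C>)"
  have "countable ?\<D>"
    using \<B>(1) \<C>(1) by simp
  moreover have "\<forall>V\<in>?\<D>. openin (prod_topology X Y) V"
    using \<B>(2) \<C>(2) by (auto simp: openin_prod_Times_iff)
  moreover have "\<exists>V\<in>?\<D>. z \<in> V \<and> V \<subseteq> U" if U: "openin (prod_topology X Y) U" "z \<in> U" for U z
  proof -
    obtain x y where z: "z = (x, y)"
      by (cases z)
    obtain S T where "openin X S" "openin Y T" "x \<in> S" "y \<in> T" "S \<times> T \<subseteq> U"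
      using U z unfolding openin_prod_topology_alt by metis
    then obtain S' T' where "S' \<in> \<B>" "x \<in> S'" "S' \<subseteq> S" "T' \<in> \<C>" "y \<in> T'" "T' \<subseteq> T"
      using \<B>(3) \<C>(3) by metis
    then have "S' \<times> T' \<in> ?\<D>" "z \<in> S' \<times> T'" "S' \<times> T' \<subseteq> U"
      using z \<open>S \<times> T \<subseteq> U\<close> by auto
    then show ?thesis
      by blast
  qed
  ultimately show ?thesis
    unfolding second_countable_def by (intro exI[of _ ?\<D>]) simp
qed

lemma smooth_on_map_prod:
  assumes V: "subspace V" "subspace W" and S: "openin (top_of_set V) S" "openin (top_of_set W) T"
    and f: "smooth_on V S f" and g: "smooth_on W T g"
  shows "smooth_on (V \<times> W) (S \<times> T) (\<lambda>y. (f (fst y), g (snd y)))"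
proof -
  have sub: "S \<subseteq> V" "T \<subseteq> W"
    using S openin_imp_subset by blast+
  have VW: "subspace (V \<times> W)"
    using V by (rule subspace_Times)
  have ST: "openin (top_of_set (V \<times> W)) (S \<times> T)"
    using S by (rule openin_Times)
  have "smooth_on (V \<times> W) (S \<times> T) (\<lambda>y. f (fst y))"
    by (rule smooth_on_compose[OF V(1) VW ST _ sub(1) f smooth_on_linear[OF linear_fst]]) auto
  moreover have "smooth_on (V \<times> W) (S \<times> T) (\<lambda>y. g (snd y))"
    by (rule smooth_on_compose[OF V(2) VW ST _ sub(2) g smooth_on_linear[OF linear_snd]]) auto
  ultimately show ?thesis
    by (rule smooth_on_Pair)
qed

lemma smooth_manifold_product:
  assumes M: "smooth_manifold M" and N: "smooth_manifold N"
  shows "smooth_manifold (product_manifold M N)"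
proof -
  let ?P = "product_manifold M N"
  have "(\<Union>(W, \<phi>)\<in>charts ?P. W) = (\<Union>(W, \<phi>)\<in>charts M. W) \<times> (\<Union>(W, \<phi>)\<in>charts N. W)"
    by (rule set_eqI, unfold mem_Times_iff in_chart_domains charts_product_manifold) (auto; blast)
  also have "\<dots> = pts ?P"
    using M N by (simp add: smooth_manifold_def)
  finally have cover: "(\<Union>(W, \<phi>)\<in>charts ?P. W) = pts ?P" .
  have chart: "openin (topo ?P) (W \<times> W') \<and> openin (top_of_set (model ?P)) (map_prod \<phi> \<psi> ` (W \<times> W')) \<and>
      homeomorphic_map (subtopology (topo ?P) (W \<times> W')) (top_of_set (map_prod \<phi> \<psi> ` (W \<times> W'))) (map_prod \<phi> \<psi>)"
    if W: "(W, \<phi>) \<in> charts M" "(W', \<psi>) \<in> charts N" for W \<phi> W' \<psi>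
  proof (intro conjI)
    show "openin (topo ?P) (W \<times> W')"
      using chart_open[OF M W(1)] chart_open[OF N W(2)] by (simp add: openin_prod_Times_iff)
    have im: "map_prod \<phi> \<psi> ` (W \<times> W') = \<phi> ` W \<times> \<psi> ` W'"
      by (rule map_prod_surj_on) auto
    show "openin (top_of_set (model ?P)) (map_prod \<phi> \<psi> ` (W \<times> W'))"
      unfolding im using chart_image_open[OF M W(1)] chart_image_open[OF N W(2)]
      by (simp add: openin_Times)
    obtain f g where "homeomorphic_maps (subtopology (topo M) W) (top_of_set (\<phi> ` W)) \<phi> f"
      "homeomorphic_maps (subtopology (topo N) W') (top_of_set (\<psi> ` W')) \<psi> g"
      using chart_homeomorphic[OF M W(1)] chart_homeomorphic[OF N W(2)]
      unfolding homeomorphic_map_maps by blast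
    then have "homeomorphic_maps (prod_topology (subtopology (topo M) W) (subtopology (topo N) W'))
      (prod_topology (top_of_set (\<phi> ` W)) (top_of_set (\<psi> ` W'))) (map_prod \<phi> \<psi>) (map_prod f g)"
      unfolding map_prod_def homeomorphic_maps_prod by blast
    then show "homeomorphic_map (subtopology (topo ?P) (W \<times> W')) (top_of_set (map_prod \<phi> \<psi> ` (W \<times> W'))) (map_prod \<phi> \<psi>)"
      unfolding im homeomorphic_map_maps by (auto simp: subtopology_Times)
  qed
  have transition: "smooth_on (model ?P) (map_prod \<phi> \<psi> ` (W \<times> W' \<inter> Y \<times> Y'))
      (map_prod \<kappa> \<zeta> \<circ> inv_into (W \<times> W') (map_prod \<phi> \<psi>))"
    if W: "(W, \<phi>) \<in> charts M" "(W', \<psi>) \<in> charts N" and Y: "(Y, \<kappa>) \<in> charts M" "(Y', \<zeta>) \<in> charts N"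
    for W \<phi> W' \<psi> Y \<kappa> Y' \<zeta>
  proof -
    have im: "map_prod \<phi> \<psi> ` (W \<times> W' \<inter> Y \<times> Y') = \<phi> ` (W \<inter> Y) \<times> \<psi> ` (W' \<inter> Y')"
      unfolding Times_Int_Times by (rule map_prod_surj_on) auto
    have "openin (topo M) (W \<inter> Y)" "openin (topo N) (W' \<inter> Y')"
      using chart_open[OF M] chart_open[OF N] W Y by blast+
    then have "openin (top_of_set (model M)) (\<phi> ` (W \<inter> Y))" "openin (top_of_set (model N)) (\<psi> ` (W' \<inter> Y'))"
      using chart_open_image[OF M W(1)] chart_open_image[OF N W(2)] by auto
    then have "smooth_on (model ?P) (\<phi> ` (W \<inter> Y) \<times> \<psi> ` (W' \<inter> Y'))
        (\<lambda>y. (\<kappa> (inv_into W \<phi> (fst y)), \<zeta> (inv_into W' \<psi> (snd y))))"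
      using smooth_on_map_prod[OF smooth_manifoldD(3)[OF M] smooth_manifoldD(3)[OF N] _ _
          chart_transition[OF M W(1) Y(1)] chart_transition[OF N W(2) Y(2)]] by simp
    then show ?thesis
      unfolding im
    proof (rule smooth_on_cong)
      fix y assume "y \<in> \<phi> ` (W \<inter> Y) \<times> \<psi> ` (W' \<inter> Y')"
      then show "(\<kappa> (inv_into W \<phi> (fst y)), \<zeta> (inv_into W' \<psi> (snd y))) =
          (map_prod \<kappa> \<zeta> \<circ> inv_into (W \<times> W') (map_prod \<phi> \<psi>)) y"
        using inv_into_map_prod[OF chart_inj[OF M W(1)] chart_inj[OF N W(2)], of "fst y" "snd y"] by auto
    qed
  qed
  have *: "subspace (model M \<times> model N)"
    using smooth_manifoldD(3)[OF M] smooth_manifoldD(3)[OF N] by (rule subspace_Times)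
  have "Hausdorff_space (topo ?P)" "second_countable (topo ?P)" "subspace (model ?P)"
    using smooth_manifoldD[OF M] smooth_manifoldD[OF N] *
    by (simp_all add: Hausdorff_space_prod_topology second_countable_prod_topology)
  moreover have "\<forall>(W, \<phi>)\<in>charts ?P. openin (topo ?P) W \<and> openin (top_of_set (model ?P)) (\<phi> ` W) \<and>
        homeomorphic_map (subtopology (topo ?P) W) (top_of_set (\<phi> ` W)) \<phi>"
    using chart unfolding Ball_def split_paired_All prod.case charts_product_manifold by blast
  moreover have "\<forall>(W, \<phi>)\<in>charts ?P. \<forall>(W', \<phi>')\<in>charts ?P.
        smooth_on (model ?P) (\<phi> ` (W \<inter> W')) (\<phi>' \<circ> inv_into W \<phi>)"
    using transition unfolding Ball_def split_paired_All prod.case charts_product_manifold by blast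
  ultimately show ?thesis
    unfolding smooth_manifold_def using cover by blast
qed

lemma smooth_map_Pair:
  assumes M: "smooth_manifold M" and N: "smooth_manifold N" and P: "smooth_manifold P"
    and f: "smooth_map M N f" and g: "smooth_map M P g"
  shows "smooth_map M (product_manifold N P) (\<lambda>x. (f x, g x))"
proof (rule smooth_mapI)
  show "continuous_map (topo M) (topo (product_manifold N P)) (\<lambda>x. (f x, g x))"
    using continuous_map_pairedI[OF smooth_map_continuous[OF f] smooth_map_continuous[OF g]] by simp
  fix W \<phi> Y \<psi>
  assume W: "(W, \<phi>) \<in> charts M" and "(Y, \<psi>) \<in> charts (product_manifold N P)"
  then obtain Z \<kappa> Z' \<zeta> where Z: "(Z, \<kappa>) \<in> charts N" "(Z', \<zeta>) \<in> charts P"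
    and *: "Y = Z \<times> Z'" "\<psi> = map_prod \<kappa> \<zeta>"
    by (auto simp: charts_product_manifold)
  have "smooth_on (model M) (\<phi> ` {x \<in> W. (f x, g x) \<in> Y}) (\<lambda>y. \<kappa> (f (inv_into W \<phi> y)))"
    by (rule smooth_on_subset[OF smooth_map_in_charts[OF f W Z(1)]]) (auto simp: *)
  moreover have "smooth_on (model M) (\<phi> ` {x \<in> W. (f x, g x) \<in> Y}) (\<lambda>y. \<zeta> (g (inv_into W \<phi> y)))"
    by (rule smooth_on_subset[OF smooth_map_in_charts[OF g W Z(2)]]) (auto simp: *)
  ultimately show "smooth_on (model M) (\<phi> ` {x \<in> W. (f x, g x) \<in> Y})
      (\<lambda>y. \<psi> (f (inv_into W \<phi> y), g (inv_into W \<phi> y)))"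
    using smooth_on_Pair by (simp add: *(2))
qed

lemma smooth_map_fst:
  assumes M: "smooth_manifold M" and N: "smooth_manifold N"
  shows "smooth_map (product_manifold M N) M fst"
proof (rule smooth_mapI)
  show "continuous_map (topo (product_manifold M N)) (topo M) fst"
    by (simp add: continuous_map_fst)
  fix Y \<phi> W' \<psi>
  assume "(Y, \<phi>) \<in> charts (product_manifold M N)" and W': "(W', \<psi>) \<in> charts M"
  then obtain Z \<kappa> Z' \<zeta> where Z: "(Z, \<kappa>) \<in> charts M" "(Z', \<zeta>) \<in> charts N"
    and *: "Y = Z \<times> Z'" "\<phi> = map_prod \<kappa> \<zeta>"
    by (auto simp: charts_product_manifold)
  have "{x \<in> Z \<times> Z'. fst x \<in> W'} = (Z \<inter> W') \<times> Z'"
    by auto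
  then have im: "map_prod \<kappa> \<zeta> ` {x \<in> Z \<times> Z'. fst x \<in> W'} = \<kappa> ` (Z \<inter> W') \<times> \<zeta> ` Z'"
    by (simp add: map_prod_surj_on)
  have "openin (topo M) (Z \<inter> W')"
    using chart_open[OF M] Z W' by blast
  then have "openin (top_of_set (model M)) (\<kappa> ` (Z \<inter> W'))"
    using chart_open_image[OF M Z(1)] by auto
  then have "smooth_on (model M \<times> model N) (\<kappa> ` (Z \<inter> W') \<times> \<zeta> ` Z') (\<lambda>y. \<psi> (inv_into Z \<kappa> (fst y)))"
    by (intro smooth_on_compose[OF smooth_manifoldD(3)[OF M] subspace_Times[OF
          smooth_manifoldD(3)[OF M] smooth_manifoldD(3)[OF N]] openin_Times[OF _
          chart_image_open[OF N Z(2)]] _ openin_imp_subset chart_transition[OF M Z(1) W']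
          smooth_on_linear[OF linear_fst]]) auto
  then show "smooth_on (model (product_manifold M N)) (\<phi> ` {x \<in> Y. fst x \<in> W'})
      (\<lambda>y. \<psi> (fst (inv_into Y \<phi> y)))"
    unfolding * product_manifold_simps im
    by (rule smooth_on_cong)
      (use inv_into_map_prod[OF chart_inj[OF M Z(1)] chart_inj[OF N Z(2)]] in auto)
qed

lemma smooth_map_snd:
  assumes M: "smooth_manifold M" and N: "smooth_manifold N"
  shows "smooth_map (product_manifold M N) N snd"
proof (rule smooth_mapI)
  show "continuous_map (topo (product_manifold M N)) (topo N) snd"
    by (simp add: continuous_map_snd)
  fix Y \<phi> W' \<psi>
  assume "(Y, \<phi>) \<in> charts (product_manifold M N)" and W': "(W', \<psi>) \<in> charts N"
  then obtain Z \<kappa> Z' \<zeta> where Z: "(Z, \<kappa>) \<in> charts M" "(Z', \<zeta>) \<in> charts N"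
    and *: "Y = Z \<times> Z'" "\<phi> = map_prod \<kappa> \<zeta>"
    by (auto simp: charts_product_manifold)
  have "{x \<in> Z \<times> Z'. snd x \<in> W'} = Z \<times> (Z' \<inter> W')"
    by auto
  then have im: "map_prod \<kappa> \<zeta> ` {x \<in> Z \<times> Z'. snd x \<in> W'} = \<kappa> ` Z \<times> \<zeta> ` (Z' \<inter> W')"
    by (simp add: map_prod_surj_on)
  have "openin (topo N) (Z' \<inter> W')"
    using chart_open[OF N] Z W' by blast
  then have "openin (top_of_set (model N)) (\<zeta> ` (Z' \<inter> W'))"
    using chart_open_image[OF N Z(2)] by auto
  then have "smooth_on (model M \<times> model N) (\<kappa> ` Z \<times> \<zeta> ` (Z' \<inter> W')) (\<lambda>y. \<psi> (inv_into Z' \<zeta> (snd y)))"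
    by (intro smooth_on_compose[OF smooth_manifoldD(3)[OF N] subspace_Times[OF
          smooth_manifoldD(3)[OF M] smooth_manifoldD(3)[OF N]] openin_Times[OF
          chart_image_open[OF M Z(1)]] _ openin_imp_subset chart_transition[OF N Z(2) W']
          smooth_on_linear[OF linear_snd]]) auto
  then show "smooth_on (model (product_manifold M N)) (\<phi> ` {x \<in> Y. snd x \<in> W'})
      (\<lambda>y. \<psi> (snd (inv_into Y \<phi> y)))"
    unfolding * product_manifold_simps im
    by (rule smooth_on_cong)
      (use inv_into_map_prod[OF chart_inj[OF M Z(1)] chart_inj[OF N Z(2)]] in auto)
qed

section \<open>Diffeomorphisms\<close>

lemma diffeomorphismI:
  assumes M: "smooth_manifold M" and N: "smooth_manifold N"
    and f: "smooth_map M N f" and g: "smooth_map N M g"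
    and gf: "\<And>x. x \<in> pts M \<Longrightarrow> g (f x) = x" and fg: "\<And>y. y \<in> pts N \<Longrightarrow> f (g y) = y"
  shows "diffeomorphism M N f"
proof -
  have bij: "bij_betw f (pts M) (pts N)"
    by (rule bij_betw_byWitness[where f' = g]) (use gf fg smooth_map_in[OF f] smooth_map_in[OF g] in auto)
  have "g y = inv_into (pts M) f y" if "y \<in> pts N" for y
    using bij that fg smooth_map_in[OF g] by (metis bij_betw_inv_into_left)
  then show ?thesis
    using bij f smooth_map_cong[OF N g] by (simp add: diffeomorphism_def)
qed

lemma diffeomorphism_inverse:
  assumes M: "smooth_manifold M" and N: "smooth_manifold N" and f: "diffeomorphism M N f"
  shows "diffeomorphism N M (inv_into (pts M) f)"
proof (rule diffeomorphismI[OF N M])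
  show "smooth_map N M (inv_into (pts M) f)" "smooth_map M N f"
    using f by (simp_all add: diffeomorphism_def)
  have "bij_betw f (pts M) (pts N)"
    using f by (simp add: diffeomorphism_def)
  then show "f (inv_into (pts M) f y) = y" if "y \<in> pts N" for y
    using that by (rule bij_betw_inv_into_right)
  show "inv_into (pts M) f (f x) = x" if "x \<in> pts M" for x
    using \<open>bij_betw f (pts M) (pts N)\<close> that by (rule bij_betw_inv_into_left)
qed

lemma diffeomorphism_imp_local_diffeomorphism:
  assumes M: "smooth_manifold M" and N: "smooth_manifold N" and f: "diffeomorphism M N f"
  shows "local_diffeomorphism M N f"
proof -
  have "f ` pts M = pts N"
    using f by (simp add: diffeomorphism_def bij_betw_imp_surj_on)
  then have "openin (topo M) (pts M) \<and> openin (topo N) (f ` pts M) \<and>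
      diffeomorphism (open_submanifold M (pts M)) (open_submanifold N (f ` pts M)) f"
    using f open_submanifold_pts[OF M] open_submanifold_pts[OF N] by simp
  then show ?thesis
    unfolding local_diffeomorphism_def by blast
qed

section \<open>Curves and tangent vectors\<close>

abbreviation interval_manifold :: "real \<Rightarrow> (real, real) manifold" where
  "interval_manifold \<epsilon> \<equiv> open_submanifold (euclidean_manifold (UNIV :: real set)) {-\<epsilon><..<\<epsilon>}"

lemma smooth_manifold_interval: "smooth_manifold (interval_manifold \<epsilon>)"
  by (intro smooth_manifold_open_submanifold smooth_manifold_euclidean) simp_all

lemma curve_at_compose:
  assumes "smooth_manifold M" "smooth_manifold N" "smooth_map M N f" "curve_at M p \<gamma>"
  shows "curve_at N (f p) (f \<circ> \<gamma>)"
proof -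
  obtain \<epsilon> where "\<gamma> 0 = p" "\<epsilon> > 0" "smooth_map (interval_manifold \<epsilon>) M \<gamma>"
    using assms(4) by (auto simp: curve_at_def)
  then show ?thesis
    using smooth_map_compose[OF smooth_manifold_interval assms(1,2) _ assms(3)]
    unfolding curve_at_def o_def by blast
qed

lemma curve_at_eventually:
  assumes "curve_at M p \<gamma>" "openin (topo M) Q" "p \<in> Q"
  obtains I where "open I" "0 \<in> I" "\<And>t. t \<in> I \<Longrightarrow> \<gamma> t \<in> Q"
proof -
  obtain \<epsilon> where \<gamma>: "\<gamma> 0 = p" "\<epsilon> > 0" "smooth_map (interval_manifold \<epsilon>) M \<gamma>"
    using assms(1) by (auto simp: curve_at_def)
  let ?I = "{t \<in> {-\<epsilon><..<\<epsilon>}. \<gamma> t \<in> Q}"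
  have "openin (top_of_set {-\<epsilon><..<\<epsilon>}) ?I"
    using openin_continuous_map_preimage[OF smooth_map_continuous[OF \<gamma>(3)] assms(2)] by simp
  then have "open ?I"
    by (rule openin_open_trans) simp
  then show thesis
    by (rule that) (use \<gamma> assms(3) in simp_all)
qed

lemma curve_at_velocity:
  assumes M: "smooth_manifold M" and \<gamma>: "curve_at M p \<gamma>" and W: "(W, \<phi>) \<in> charts M" "p \<in> W"
  shows "((\<phi> \<circ> \<gamma>) has_vector_derivative vector_derivative (\<phi> \<circ> \<gamma>) (at 0)) (at 0)"
    and "vector_derivative (\<phi> \<circ> \<gamma>) (at 0) \<in> model M"
proof -
  obtain \<epsilon> where \<epsilon>: "\<gamma> 0 = p" "\<epsilon> > 0" "smooth_map (interval_manifold \<epsilon>) M \<gamma>"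
    using \<gamma> by (auto simp: curve_at_def)
  let ?J = "{-\<epsilon><..<\<epsilon>}"
  have J: "(?J, \<lambda>t. t) \<in> charts (interval_manifold \<epsilon>)"
    by (simp add: charts_open_submanifold)
  define I where "I = {t \<in> ?J. \<gamma> t \<in> W}"
  have "openin (top_of_set (UNIV :: real set)) I"
    using smooth_map_chart_domain_open[OF smooth_manifold_interval M \<epsilon>(3) J W(1)] by (simp add: I_def)
  then have I: "open I" "0 \<in> I"
    using \<epsilon> W(2) by (auto simp: I_def)
  have "smooth_on UNIV I (\<lambda>t. \<phi> (\<gamma> (inv_into ?J (\<lambda>t. t) t)))"
    using smooth_map_in_charts[OF \<epsilon>(3) J W(1)] by (simp add: I_def)
  then have "smooth_on UNIV I (\<phi> \<circ> \<gamma>)"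
    by (rule smooth_on_cong) (simp add: I_def)
  then have "C_k_on (Suc 0) UNIV I (\<phi> \<circ> \<gamma>)"
    unfolding smooth_on_def by blast
  then obtain D where D: "\<And>t. t \<in> I \<Longrightarrow> ((\<phi> \<circ> \<gamma>) has_derivative D t) (at t within I)"
    by (rule C_k_on_SucE) (rule that)
  then have "((\<phi> \<circ> \<gamma>) has_derivative D 0) (at 0)"
    using D[OF I(2)] at_within_open[OF I(2,1)] by simp
  then have "(\<phi> \<circ> \<gamma>) differentiable at 0"
    by (rule differentiableI)
  then show der: "((\<phi> \<circ> \<gamma>) has_vector_derivative vector_derivative (\<phi> \<circ> \<gamma>) (at 0)) (at 0)"
    using vector_derivative_works by blast
  have "(\<phi> \<circ> \<gamma>) t \<in> model M" if "t \<in> I" for t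
    using that openin_imp_subset[OF chart_image_open[OF M W(1)]] by (auto simp: I_def)
  then have "\<forall>\<^sub>F t in nhds 0. (\<phi> \<circ> \<gamma>) t \<in> model M"
    using I eventually_nhds by blast
  then show "vector_derivative (\<phi> \<circ> \<gamma>) (at 0) \<in> model M"
    using has_vector_derivative_in_subspace[OF smooth_manifoldD(3)[OF M] der] by blast
qed

text \<open>
The chain rule in charts: \<open>D\<close> depends on \<open>f\<close> and the two charts, but not on the curve.
\<close>

lemma smooth_map_velocity:
  assumes M: "smooth_manifold M" and N: "smooth_manifold N" and f: "smooth_map M N f"
    and W: "(W, \<phi>) \<in> charts M" "p \<in> W" and W': "(W', \<psi>) \<in> charts N" "f p \<in> W'"
    and D: "((\<lambda>y. \<psi> (f (inv_into W \<phi> y))) has_derivative D) (at (\<phi> p) within \<phi> ` {x \<in> W. f x \<in> W'})"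
    and \<gamma>: "curve_at M p \<gamma>"
  shows "vector_derivative (\<psi> \<circ> (f \<circ> \<gamma>)) (at 0) = D (vector_derivative (\<phi> \<circ> \<gamma>) (at 0))"
proof -
  let ?Q = "{x \<in> W. f x \<in> W'}" and ?w = "vector_derivative (\<phi> \<circ> \<gamma>) (at 0)"
  have "openin (topo M) ?Q"
    using openin_continuous_map_preimage_gen[OF smooth_map_continuous[OF f] chart_open[OF M W(1)]
        chart_open[OF N W'(1)]] .
  moreover have "p \<in> ?Q"
    using W(2) W'(2) by simp
  ultimately obtain I where I: "open I" "0 \<in> I" "\<And>t. t \<in> I \<Longrightarrow> \<gamma> t \<in> ?Q"
    by (rule curve_at_eventually[OF \<gamma>]) (rule that)
  have "((\<phi> \<circ> \<gamma>) has_derivative (\<lambda>t. t *\<^sub>R ?w)) (at 0 within I)"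
    using curve_at_velocity(1)[OF M \<gamma> W] unfolding has_vector_derivative_def
    by (rule has_derivative_at_withinI)
  moreover have "((\<lambda>y. \<psi> (f (inv_into W \<phi> y))) has_derivative D)
      (at ((\<phi> \<circ> \<gamma>) 0) within (\<phi> \<circ> \<gamma>) ` I)"
  proof -
    have "(\<phi> \<circ> \<gamma>) 0 = \<phi> p"
      using \<gamma> by (simp add: curve_at_def)
    moreover have "(\<phi> \<circ> \<gamma>) ` I \<subseteq> \<phi> ` ?Q"
      using I(3) by (auto simp: image_comp[symmetric])
    ultimately show ?thesis
      using has_derivative_subset[OF D] by simp
  qed
  ultimately have "((\<lambda>y. \<psi> (f (inv_into W \<phi> y))) \<circ> (\<phi> \<circ> \<gamma>) has_derivative D \<circ> (\<lambda>t. t *\<^sub>R ?w)) (at 0 within I)"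
    by (rule diff_chain_within)
  moreover have "D \<circ> (\<lambda>t. t *\<^sub>R ?w) = (\<lambda>t. t *\<^sub>R D ?w)"
    using linear_cmul[OF has_derivative_linear[OF D]] by (simp add: o_def)
  ultimately have "((\<lambda>y. \<psi> (f (inv_into W \<phi> y))) \<circ> (\<phi> \<circ> \<gamma>) has_derivative (\<lambda>t. t *\<^sub>R D ?w)) (at 0 within I)"
    by simp
  then have "((\<psi> \<circ> (f \<circ> \<gamma>)) has_derivative (\<lambda>t. t *\<^sub>R D ?w)) (at 0 within I)"
  proof (rule has_derivative_transform[OF I(2), rotated])
    show "(\<psi> \<circ> (f \<circ> \<gamma>)) t = ((\<lambda>y. \<psi> (f (inv_into W \<phi> y))) \<circ> (\<phi> \<circ> \<gamma>)) t" if "t \<in> I" for t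
      using I(3)[OF that] chart_inj[OF M W(1)] by simp
  qed
  then have "((\<psi> \<circ> (f \<circ> \<gamma>)) has_vector_derivative D ?w) (at 0)"
    unfolding has_vector_derivative_def using at_within_open[OF I(2,1)] by simp
  then show ?thesis
    by (rule vector_derivative_at)
qed

text \<open>
The curve is a straight line in the chart.
\<close>

lemma curve_with_velocity:
  assumes M: "smooth_manifold M" and W: "(W, \<phi>) \<in> charts M" "p \<in> W" and w: "w \<in> model M"
  obtains \<gamma> where "curve_at M p \<gamma>" "vector_derivative (\<phi> \<circ> \<gamma>) (at 0) = w"
proof -
  let ?V = "model M" and ?c = "\<lambda>t. \<phi> p + t *\<^sub>R w"
  have V: "subspace ?V"
    by (rule smooth_manifoldD(3)[OF M])
  obtain Q where Q: "open Q" "\<phi> ` W = ?V \<inter> Q"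
    using chart_image_open[OF M W(1)] by (auto simp: openin_open)
  have "\<phi> p \<in> \<phi> ` W"
    using W(2) by (rule imageI)
  then have "open (?c -` Q)" "0 \<in> ?c -` Q"
    using Q by (auto intro!: open_vimage continuous_intros)
  then obtain \<epsilon> where \<epsilon>: "\<epsilon> > 0" "\<And>t. dist t 0 < \<epsilon> \<Longrightarrow> t \<in> ?c -` Q"
    unfolding open_dist by blast
  let ?J = "{-\<epsilon><..<\<epsilon>}"
  have c: "?c t \<in> \<phi> ` W" if "t \<in> ?J" for t
  proof -
    have "?c t \<in> ?V"
      using V w \<open>\<phi> p \<in> \<phi> ` W\<close> Q by (simp add: subspace_add subspace_mul)
    moreover have "?c t \<in> Q"
      using \<epsilon>(2)[of t] that by (auto simp: dist_real_def)
    ultimately show ?thesis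
      using Q(2) by blast
  qed
  define \<gamma> where "\<gamma> t = inv_into W \<phi> (?c t)" for t
  have "smooth_on UNIV ?J ?c"
    unfolding smooth_on_def
  proof
    have "linear (\<lambda>t. t *\<^sub>R w)"
      by (simp add: linear_iff scaleR_add_left)
    then show "C_k_on k UNIV ?J ?c" for k
      by (intro C_k_on_add C_k_on_const C_k_on_linear)
  qed
  then have "smooth_map (interval_manifold \<epsilon>) (open_submanifold (euclidean_manifold ?V) (\<phi> ` W)) ?c"
    using c Q(2) by (intro smooth_map_between_euclidean) auto
  moreover have E: "smooth_manifold (open_submanifold (euclidean_manifold ?V) (\<phi> ` W))"
    using V chart_image_open[OF M W(1)]
    by (intro smooth_manifold_open_submanifold smooth_manifold_euclidean) simp_all
  moreover have MW: "smooth_manifold (open_submanifold M W)"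
    by (rule smooth_manifold_open_submanifold[OF M chart_open[OF M W(1)]])
  ultimately have "smooth_map (interval_manifold \<epsilon>) (open_submanifold M W) \<gamma>"
    unfolding \<gamma>_def
    using smooth_map_compose[OF smooth_manifold_interval E MW _ smooth_map_chart_inverse[OF M W(1)]] by blast
  then have "smooth_map (interval_manifold \<epsilon>) M \<gamma>"
    by (rule smooth_map_extend_codomain[OF smooth_manifold_interval M _ chart_open[OF M W(1)]])
  moreover have "\<gamma> 0 = p"
    using chart_inj[OF M W(1)] W(2) by (simp add: \<gamma>_def)
  ultimately have "curve_at M p \<gamma>"
    using \<epsilon>(1) by (auto simp: curve_at_def)
  moreover have "((\<phi> \<circ> \<gamma>) has_vector_derivative w) (at 0)"
  proof -
    have "(?c has_derivative (\<lambda>t. t *\<^sub>R w)) (at 0 within ?J)"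
      using has_derivative_add[OF has_derivative_const has_derivative_scaleR_left[OF has_derivative_ident]]
      by simp
    then have "((\<phi> \<circ> \<gamma>) has_derivative (\<lambda>t. t *\<^sub>R w)) (at 0 within ?J)"
    proof (rule has_derivative_transform[rotated 2])
      show "0 \<in> ?J"
        using \<epsilon>(1) by simp
      show "(\<phi> \<circ> \<gamma>) t = ?c t" if "t \<in> ?J" for t
        using f_inv_into_f[OF c[OF that]] by (simp add: \<gamma>_def)
    qed
    then show ?thesis
      using \<epsilon>(1) at_within_open[of 0 ?J] by (simp add: has_vector_derivative_def)
  qed
  then have "vector_derivative (\<phi> \<circ> \<gamma>) (at 0) = w"
    by (rule vector_derivative_at)
  ultimately show thesis
    by (rule that)
qed

lemma curve_at_in: "curve_at M p \<gamma> \<Longrightarrow> p \<in> pts M"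
  unfolding curve_at_def using smooth_map_in[of "interval_manifold _" M \<gamma> 0] by fastforce

lemma tangent_class_cong:
  assumes "\<gamma> 0 = \<delta> 0"
    and "\<And>W \<phi>. (W, \<phi>) \<in> charts M \<Longrightarrow> \<gamma> 0 \<in> W \<Longrightarrow>
      vector_derivative (\<phi> \<circ> \<gamma>) (at 0) = vector_derivative (\<phi> \<circ> \<delta>) (at 0)"
  shows "tangent_class M \<gamma> = tangent_class M \<delta>"
  unfolding tangent_class_def using assms by fastforce

lemma tangent_class_germ:
  assumes "\<forall>\<^sub>F t in nhds 0. \<gamma> t = \<delta> t"
  shows "tangent_class M \<gamma> = tangent_class M \<delta>"
proof (rule tangent_class_cong)
  show "\<gamma> 0 = \<delta> 0"
    using eventually_nhds_x_imp_x[OF assms] .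
  show "vector_derivative (\<phi> \<circ> \<gamma>) (at 0) = vector_derivative (\<phi> \<circ> \<delta>) (at 0)" for \<phi>
    using assms by (intro vector_derivative_cong_eq) (auto elim: eventually_mono)
qed

lemma tangent_class_self: "curve_at M p \<gamma> \<Longrightarrow> \<gamma> \<in> tangent_class M \<gamma>"
  by (simp add: tangent_class_def curve_at_def)

lemma tangent_class_memD:
  assumes "\<delta> \<in> tangent_class M \<gamma>"
  shows "curve_at M (\<gamma> 0) \<delta>"
    and "(W, \<phi>) \<in> charts M \<Longrightarrow> \<gamma> 0 \<in> W \<Longrightarrow>
      vector_derivative (\<phi> \<circ> \<delta>) (at 0) = vector_derivative (\<phi> \<circ> \<gamma>) (at 0)"
  using assms by (auto simp: tangent_class_def)

text \<open>
Equality of velocities in a single chart around \<open>p\<close> is enough: with the identity as \<open>f\<close>, it passes to all other charts.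
\<close>

lemma tangent_class_compose:
  assumes M: "smooth_manifold M" and N: "smooth_manifold N" and f: "smooth_map M N f"
    and \<gamma>: "curve_at M p \<gamma>" and \<delta>: "curve_at M p \<delta>" and W: "(W, \<phi>) \<in> charts M" "p \<in> W"
    and eq: "vector_derivative (\<phi> \<circ> \<gamma>) (at 0) = vector_derivative (\<phi> \<circ> \<delta>) (at 0)"
  shows "tangent_class N (f \<circ> \<gamma>) = tangent_class N (f \<circ> \<delta>)"
proof (rule tangent_class_cong)
  have 0: "\<gamma> 0 = p" "\<delta> 0 = p"
    using \<gamma> \<delta> by (simp_all add: curve_at_def)
  then show "(f \<circ> \<gamma>) 0 = (f \<circ> \<delta>) 0"
    by simp
  fix W' \<psi> assume W': "(W', \<psi>) \<in> charts N" "(f \<circ> \<gamma>) 0 \<in> W'"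
  let ?S = "\<phi> ` {x \<in> W. f x \<in> W'}"
  have "smooth_on (model M) ?S (\<lambda>y. \<psi> (f (inv_into W \<phi> y)))"
    by (rule smooth_map_in_charts[OF f W(1) W'(1)])
  then have "C_k_on (Suc 0) (model M) ?S (\<lambda>y. \<psi> (f (inv_into W \<phi> y)))"
    unfolding smooth_on_def by blast
  then obtain D where "\<And>y. y \<in> ?S \<Longrightarrow> ((\<lambda>y. \<psi> (f (inv_into W \<phi> y))) has_derivative D y) (at y within ?S)"
    by (rule C_k_on_SucE) (rule that)
  moreover have "f p \<in> W'"
    using W'(2) 0 by simp
  ultimately have "((\<lambda>y. \<psi> (f (inv_into W \<phi> y))) has_derivative D (\<phi> p)) (at (\<phi> p) within ?S)"
    using W(2) by blast
  from smooth_map_velocity[OF M N f W W'(1) \<open>f p \<in> W'\<close> this]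
  show "vector_derivative (\<psi> \<circ> (f \<circ> \<gamma>)) (at 0) = vector_derivative (\<psi> \<circ> (f \<circ> \<delta>)) (at 0)"
    using \<gamma> \<delta> eq by simp
qed

text \<open>
All terms of the union that defines \<open>tangent_map\<close> coincide, so the push-forward may be computed on any
representative.
\<close>

lemma tangent_map_class:
  assumes M: "smooth_manifold M" and N: "smooth_manifold N" and f: "smooth_map M N f"
    and \<gamma>: "curve_at M p \<gamma>"
  shows "tangent_map N f (tangent_class M \<gamma>) = tangent_class N (f \<circ> \<gamma>)"
proof -
  have p: "\<gamma> 0 = p"
    using \<gamma> by (simp add: curve_at_def)
  obtain W \<phi> where W: "(W, \<phi>) \<in> charts M" "p \<in> W"
    by (rule chart_exists[OF M curve_at_in[OF \<gamma>]])
  have "tangent_class N (f \<circ> \<delta>) = tangent_class N (f \<circ> \<gamma>)" if "\<delta> \<in> tangent_class M \<gamma>" for \<delta>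
    using tangent_class_memD[OF that] p W by (intro tangent_class_compose[OF M N f _ \<gamma> W]) auto
  then show ?thesis
    unfolding tangent_map_def using tangent_class_self[OF \<gamma>] by blast
qed

text \<open>
A curve through a point of \<open>U\<close> stays in \<open>U\<close> after its parameter interval is shrunk.
\<close>

lemma curve_at_open_submanifold:
  assumes M: "smooth_manifold M" and U: "openin (topo M) U" "p \<in> U"
  shows "curve_at (open_submanifold M U) p \<gamma> \<longleftrightarrow> curve_at M p \<gamma>"
proof
  assume "curve_at (open_submanifold M U) p \<gamma>"
  then show "curve_at M p \<gamma>"
    using smooth_map_extend_codomain[OF smooth_manifold_interval M _ U(1)] unfolding curve_at_def by blast
next
  assume \<gamma>: "curve_at M p \<gamma>"
  then obtain \<epsilon> where \<epsilon>: "\<gamma> 0 = p" "\<epsilon> > 0" "smooth_map (interval_manifold \<epsilon>) M \<gamma>"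
    by (auto simp: curve_at_def)
  obtain I where I: "open I" "0 \<in> I" "\<And>t. t \<in> I \<Longrightarrow> \<gamma> t \<in> U"
    by (rule curve_at_eventually[OF \<gamma> U]) (rule that)
  then obtain r where r: "r > 0" "\<And>t. dist t 0 < r \<Longrightarrow> t \<in> I"
    unfolding open_dist by blast
  \<comment> \<open>small enough for \<open>\<gamma>\<close> to be smooth and to stay in \<open>U\<close>\<close>
  define \<eta> where "\<eta> = min r \<epsilon>"
  have J: "max (- \<epsilon>) (- \<eta>) = - \<eta>" "min \<epsilon> \<eta> = \<eta>"
    by (auto simp: \<eta>_def)
  have eq: "open_submanifold (interval_manifold \<epsilon>) {-\<eta><..<\<eta>} = interval_manifold \<eta>"
    by (simp add: open_submanifold_def euclidean_manifold_def subtopology_subtopology J)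
  have "openin (topo (interval_manifold \<epsilon>)) {-\<eta><..<\<eta>}"
    unfolding topo_open_submanifold euclidean_manifold_simps openin_open subtopology_UNIV
    by (rule exI[of _ "{-\<eta><..<\<eta>}"]) (simp add: J)
  moreover have "\<gamma> ` {-\<eta><..<\<eta>} \<subseteq> U"
    using r(2) I(3) by (auto simp: \<eta>_def dist_real_def)
  ultimately have "smooth_map (interval_manifold \<eta>) (open_submanifold M U) \<gamma>"
    using smooth_map_open_submanifold[OF smooth_manifold_interval \<epsilon>(3) _ U(1)] eq by metis
  moreover have "\<eta> > 0"
    using r(1) \<epsilon>(2) by (simp add: \<eta>_def)
  ultimately show "curve_at (open_submanifold M U) p \<gamma>"
    using \<epsilon>(1) unfolding curve_at_def by blast
qed

lemma tangent_class_open_submanifold: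
  assumes "smooth_manifold M" "openin (topo M) U" "\<gamma> 0 \<in> U"
  shows "tangent_class (open_submanifold M U) \<gamma> = tangent_class M \<gamma>"
proof -
  have "(\<forall>(Y, \<phi>)\<in>charts (open_submanifold M U). \<gamma> 0 \<in> Y \<longrightarrow> P \<phi>) \<longleftrightarrow>
      (\<forall>(W, \<phi>)\<in>charts M. \<gamma> 0 \<in> W \<longrightarrow> P \<phi>)" for P
    using assms(3) unfolding Ball_def split_paired_All prod.case charts_open_submanifold by blast
  then show ?thesis
    unfolding tangent_class_def using curve_at_open_submanifold[OF assms] by simp
qed

lemma tangent_space_open_submanifold:
  assumes "smooth_manifold M" "openin (topo M) U" "p \<in> U"
  shows "tangent_space (open_submanifold M U) p = tangent_space M p"
proof -
  have "tangent_class (open_submanifold M U) \<gamma> = tangent_class M \<gamma>" if "curve_at M p \<gamma>" for \<gamma>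
    using tangent_class_open_submanifold[OF assms(1,2)] that assms(3) by (simp add: curve_at_def)
  then show ?thesis
    unfolding tangent_space_def using curve_at_open_submanifold[OF assms] by blast
qed

lemma vector_field_open_submanifold:
  assumes M: "smooth_manifold M" and X: "vector_field M X" and U: "openin (topo M) U"
  shows "vector_field (open_submanifold M U) X"
  unfolding vector_field_def
proof
  show "\<forall>p\<in>pts (open_submanifold M U). X p \<in> tangent_space (open_submanifold M U) p"
    using X tangent_space_open_submanifold[OF M U] by (auto simp: vector_field_def)
  have "smooth_on (model M) (\<phi> ` (W \<inter> U)) (\<lambda>y. chart_velocity \<phi> (X (inv_into (W \<inter> U) \<phi> y)))"
    if W: "(W, \<phi>) \<in> charts M" for W \<phi>
  proof -
    have "smooth_on (model M) (\<phi> ` W) (\<lambda>y. chart_velocity \<phi> (X (inv_into W \<phi> y)))"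
      using X W by (auto simp: vector_field_def)
    then have "smooth_on (model M) (\<phi> ` (W \<inter> U)) (\<lambda>y. chart_velocity \<phi> (X (inv_into W \<phi> y)))"
      by (rule smooth_on_subset) auto
    then show ?thesis
      by (rule smooth_on_cong) (simp add: inv_into_Int[OF chart_inj[OF M W]])
  qed
  then show "\<forall>(W, \<phi>)\<in>charts (open_submanifold M U). smooth_on (model (open_submanifold M U)) (\<phi> ` W)
      (\<lambda>y. chart_velocity \<phi> (X (inv_into W \<phi> y)))"
    unfolding Ball_def split_paired_All prod.case charts_open_submanifold model_open_submanifold by blast
qed

section \<open>Straightening a submersion\<close>

text \<open>
By rank and nullity the kernel \<open>Z\<close> of \<open>D\<close> on \<open>V\<close> has the dimension of \<open>K\<close>. The map \<open>A\<close> is an isomorphism from \<open>Z\<close> to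
\<open>K\<close> after a projection onto \<open>Z\<close>; a common zero of \<open>A\<close> and \<open>D\<close> lies in \<open>Z\<close>, where \<open>A\<close> is injective, and
surjectivity follows by counting dimensions.
\<close>

lemma linear_complement_of_surjection:
  fixes D :: "'e::euclidean_space \<Rightarrow> 'g::euclidean_space" and K :: "'k::euclidean_space set"
  assumes D: "linear D" and V: "subspace V" and W: "subspace W" "D ` V = W" and K: "subspace K"
    and dim: "dim K + dim W = dim V"
  obtains A where "linear A" "range A \<subseteq> K" "inj_on (\<lambda>v. (A v, D v)) V" "(\<lambda>v. (A v, D v)) ` V = K \<times> W"
proof -
  define Z where "Z = {v \<in> V. D v = 0}"
  have Z: "subspace Z"
    using V D by (auto simp: Z_def subspace_def linear_0 linear_add linear_cmul)
  obtain R where R: "range R \<subseteq> V" "linear R" "\<And>w. w \<in> W \<Longrightarrow> D (R w) = w"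
    using linear_exists_right_inverse_on[OF D V] W(2) by blast
  have "inj_on R W"
    using R(3) by (metis inj_onI)
  then have RW: "subspace (R ` W)" "dim (R ` W) = dim W"
    using R(2) W(1) by (simp_all add: linear_subspace_image dim_image_eq span_eq_iff[THEN iffD2])
  have sum: "{x + y |x y. x \<in> Z \<and> y \<in> R ` W} = V"
  proof (intro equalityI subsetI)
    fix v assume "v \<in> {x + y |x y. x \<in> Z \<and> y \<in> R ` W}"
    then show "v \<in> V"
      using V R(1) by (auto simp: Z_def intro!: subspace_add)
  next
    fix v assume v: "v \<in> V"
    have "D v \<in> W"
      using v W(2) by blast
    moreover have "R (D v) \<in> V"
      using R(1) by blast
    ultimately have "v - R (D v) \<in> Z"
      using v V R(3) D by (simp add: Z_def linear_diff subspace_diff)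
    moreover have "v = (v - R (D v)) + R (D v)"
      by simp
    ultimately show "v \<in> {x + y |x y. x \<in> Z \<and> y \<in> R ` W}"
      using \<open>D v \<in> W\<close> by blast
  qed
  have "Z \<inter> R ` W = {0}"
  proof (intro equalityI subsetI)
    fix v assume "v \<in> Z \<inter> R ` W"
    then obtain w where "w \<in> W" "v = R w" "D v = 0"
      by (auto simp: Z_def)
    then show "v \<in> {0}"
      using R(2,3) by (simp add: linear_0)
  qed (use Z RW subspace_0 in auto)
  then have "dim V = dim Z + dim W"
    using dim_sums_Int[OF Z RW(1)] sum RW(2) by simp
  then have "dim Z = dim K"
    using dim by simp
  then obtain f g where f: "linear f" "f ` Z = K" and g: "\<And>x. x \<in> Z \<Longrightarrow> g (f x) = x" "linear g"
    using isometries_subspaces[OF Z K] by metis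
  have "inj_on (\<lambda>x. x) Z"
    by (simp add: inj_on_def)
  then obtain P where P: "range P \<subseteq> Z" "linear P" "\<And>v. v \<in> Z \<Longrightarrow> P v = v"
    using linear_exists_left_inverse_on[OF linear_ident Z] by blast
  let ?A = "\<lambda>v. f (P v)" and ?AD = "\<lambda>v. (f (P v), D v)"
  have A: "linear ?A"
    using linear_compose[OF P(2) f(1)] by (simp add: o_def)
  have rA: "range ?A \<subseteq> K"
    using P(1) f(2) by auto
  have AD: "linear ?AD"
    using A D by (simp add: linear_iff)
  have inj: "inj_on ?AD V"
  proof (rule linear_inj_on_iff_eq_0[OF AD V, THEN iffD2], intro ballI impI)
    fix v assume "v \<in> V" "?AD v = 0"
    then have "v \<in> Z" "f (P v) = 0"
      by (auto simp: Z_def zero_prod_def)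
    then show "v = 0"
      using P(3) g linear_0 by metis
  qed
  have "?AD ` V = K \<times> W"
  proof (rule subspace_dim_equal)
    show "subspace (?AD ` V)"
      using AD V by (rule linear_subspace_image)
    show "subspace (K \<times> W)"
      using K W(1) by (rule subspace_Times)
    show "?AD ` V \<subseteq> K \<times> W"
      using rA W(2) by auto
    have "dim (?AD ` V) = dim V"
      using inj V by (intro dim_image_eq[OF AD]) (simp add: span_eq_iff[THEN iffD2])
    then show "dim (?AD ` V) \<ge> dim (K \<times> W)"
      using dim dim_Times[OF K W(1)] by simp
  qed
  then show thesis
    using that[OF A rA inj] by blast
qed

text \<open>
Every vector of a model space is the velocity of a curve, so surjectivity of the tangent map, which is a statement
about classes of curves, becomes surjectivity of the derivative of the coordinate expression.
\<close>

lemma derivative_image_of_submersion: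
  assumes M: "smooth_manifold M" and N: "smooth_manifold N" and f: "smooth_map M N f"
    and surj: "tangent_map N f ` tangent_space M p = tangent_space N (f p)"
    and W: "(W, \<phi>) \<in> charts M" "p \<in> W" and W': "(W', \<psi>) \<in> charts N" "f p \<in> W'"
    and D: "((\<lambda>y. \<psi> (f (inv_into W \<phi> y))) has_derivative D) (at (\<phi> p) within \<phi> ` {x \<in> W. f x \<in> W'})"
  shows "D ` model M = model N"
proof (intro equalityI subsetI)
  note velocity = smooth_map_velocity[OF M N f W W' D]
  fix w assume "w \<in> D ` model M"
  then obtain v where v: "v \<in> model M" "w = D v"
    by blast
  obtain \<gamma> where \<gamma>: "curve_at M p \<gamma>" "vector_derivative (\<phi> \<circ> \<gamma>) (at 0) = v"
    by (rule curve_with_velocity[OF M W v(1)])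
  then have "w = vector_derivative (\<psi> \<circ> (f \<circ> \<gamma>)) (at 0)"
    using velocity[OF \<gamma>(1)] v(2) by simp
  then show "w \<in> model N"
    using curve_at_velocity(2)[OF N curve_at_compose[OF M N f \<gamma>(1)] W'] by simp
next
  note velocity = smooth_map_velocity[OF M N f W W' D]
  fix w assume "w \<in> model N"
  then obtain \<beta> where \<beta>: "curve_at N (f p) \<beta>" "vector_derivative (\<psi> \<circ> \<beta>) (at 0) = w"
    by (rule curve_with_velocity[OF N W'])
  then have "tangent_class N \<beta> \<in> tangent_space N (f p)"
    unfolding tangent_space_def by blast
  then have "tangent_class N \<beta> \<in> tangent_map N f ` tangent_space M p"
    using surj by simp
  then obtain \<gamma> where \<gamma>: "curve_at M p \<gamma>" "tangent_class N \<beta> = tangent_map N f (tangent_class M \<gamma>)"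
    unfolding tangent_space_def by blast
  then have "tangent_class N \<beta> = tangent_class N (f \<circ> \<gamma>)"
    using tangent_map_class[OF M N f \<gamma>(1)] by simp
  then have "f \<circ> \<gamma> \<in> tangent_class N \<beta>"
    using tangent_class_self[OF curve_at_compose[OF M N f \<gamma>(1)]] by simp
  moreover have "\<beta> 0 = f p"
    using \<beta>(1) by (simp add: curve_at_def)
  ultimately have "vector_derivative (\<psi> \<circ> (f \<circ> \<gamma>)) (at 0) = w"
    using tangent_class_memD(2) \<beta>(2) W' by metis
  then have "w = D (vector_derivative (\<phi> \<circ> \<gamma>) (at 0))"
    using velocity[OF \<gamma>(1)] by simp
  then show "w \<in> D ` model M"
    using curve_at_velocity(2)[OF M \<gamma>(1) W] by blast
qed

lemma open_submanifold_open_submanifold: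
  assumes "U \<subseteq> W"
  shows "open_submanifold (open_submanifold M W) U = open_submanifold M U"
proof -
  have "{(Y \<inter> U, \<phi>) | Y \<phi>. (Y, \<phi>) \<in> {(Y \<inter> W, \<phi>) | Y \<phi>. (Y, \<phi>) \<in> charts M}} =
      {(Y \<inter> W \<inter> U, \<phi>) | Y \<phi>. (Y, \<phi>) \<in> charts M}"
    by blast
  moreover have "Y \<inter> W \<inter> U = Y \<inter> U" for Y
    using assms by blast
  moreover have "W \<inter> U = U"
    using assms by blast
  ultimately show ?thesis
    by (simp add: open_submanifold_def subtopology_subtopology)
qed

lemma
  assumes M: "smooth_manifold M" and W: "(W, \<phi>) \<in> charts M"
    and R: "openin (top_of_set (model M)) R" "R \<subseteq> \<phi> ` W"
  shows chart_preimage_open: "openin (topo M) {x \<in> W. \<phi> x \<in> R}"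
    and smooth_map_chart_restrict: "smooth_map (open_submanifold M {x \<in> W. \<phi> x \<in> R})
      (open_submanifold (euclidean_manifold (model M)) R) \<phi>"
    and smooth_map_chart_inverse_restrict: "smooth_map (open_submanifold (euclidean_manifold (model M)) R)
      (open_submanifold M {x \<in> W. \<phi> x \<in> R}) (inv_into W \<phi>)"
proof -
  let ?U = "{x \<in> W. \<phi> x \<in> R}" and ?E = "euclidean_manifold (model M)"
  note inj = chart_inj[OF M W]
  note MW = smooth_manifold_open_submanifold[OF M chart_open[OF M W]]
  have E: "smooth_manifold (open_submanifold ?E (\<phi> ` W))"
    using smooth_manifoldD(3)[OF M] chart_image_open[OF M W]
    by (intro smooth_manifold_open_submanifold smooth_manifold_euclidean) simp_all
  have im: "\<phi> ` W \<subseteq> model M"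
    using chart_image_open[OF M W] by (rule openin_imp_subset)
  have R': "openin (topo (open_submanifold ?E (\<phi> ` W))) R"
    using R im openin_subset_trans[OF R(1) R(2) im]
    by (simp add: subtopology_subtopology Int_absorb1)
  have "openin (subtopology (topo M) W) {x \<in> topspace (subtopology (topo M) W). \<phi> x \<in> R}"
    using R' im openin_continuous_map_preimage[OF chart_continuous[OF M W]]
    by (simp add: subtopology_subtopology Int_absorb1 del: topspace_subtopology)
  then have U': "openin (subtopology (topo M) W) ?U"
    unfolding chart_subtopology_topspace[OF M W] .
  then show "openin (topo M) ?U"
    using openin_open_subtopology[OF chart_open[OF M W]] by blast
  have sub: "?U \<subseteq> W"
    by blast
  show "smooth_map (open_submanifold M ?U) (open_submanifold ?E R) \<phi>"
    using smooth_map_open_submanifold[OF MW smooth_map_chart[OF M W] _ R', of ?U] U'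
    by (auto simp: open_submanifold_open_submanifold[OF sub] open_submanifold_open_submanifold[OF R(2)])
  have "openin (topo (open_submanifold M W)) ?U"
    using U' by simp
  moreover have "inv_into W \<phi> ` R \<subseteq> ?U"
    using R(2) inj by auto
  ultimately show "smooth_map (open_submanifold ?E R) (open_submanifold M ?U) (inv_into W \<phi>)"
    using smooth_map_open_submanifold[OF E smooth_map_chart_inverse[OF M W] R', of ?U]
    by (simp add: open_submanifold_open_submanifold[OF sub] open_submanifold_open_submanifold[OF R(2)])
qed

text \<open>
The local normal form of a submersion. The first component is a linear function \<open>A\<close> of a chart of \<open>M\<close>, chosen to
complement the derivative of \<open>F\<close> in coordinates; then \<open>G = (A, f)\<close>, with \<open>f\<close> the coordinate expression of \<open>F\<close>, is
locally invertible. The neighbourhood \<open>U\<close> is the preimage of a product of open sets, so that its image under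
\<open>(\<pi>, F)\<close> is a full product.
\<close>

lemma submersion_local_trivialisation:
  fixes K :: "'k::euclidean_space set"
  assumes M: "smooth_manifold M" and L: "smooth_manifold L" and F: "smooth_map M L F"
    and m: "m \<in> pts M" and surj: "tangent_map L F ` tangent_space M m = tangent_space L (F m)"
    and K: "subspace K" "dim K + mdim L = mdim M"
  obtains U and \<pi> :: "'a \<Rightarrow> 'k" where "openin (topo M) U" "m \<in> U"
    "openin (top_of_set K) (\<pi> ` U)" "openin (topo L) (F ` U)"
    "diffeomorphism (open_submanifold M U)
      (product_manifold (open_submanifold (euclidean_manifold K) (\<pi> ` U)) (open_submanifold L (F ` U)))
      (\<lambda>x. (\<pi> x, F x))"
proof -
  let ?V = "model M" and ?W = "model L"
  note V = smooth_manifoldD(3)[OF M] and W = smooth_manifoldD(3)[OF L]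
  obtain Y \<phi> where Y: "(Y, \<phi>) \<in> charts M" "m \<in> Y"
    by (rule chart_exists[OF M m])
  obtain Z \<psi> where Z: "(Z, \<psi>) \<in> charts L" "F m \<in> Z"
    by (rule chart_exists[OF L smooth_map_in[OF F m]])
  note inj = chart_inj[OF M Y(1)] chart_inj[OF L Z(1)]
  define f where "f = (\<lambda>y. \<psi> (F (inv_into Y \<phi> y)))"
  define S where "S = \<phi> ` {x \<in> Y. F x \<in> Z}"
  have f_chart: "f (\<phi> x) = \<psi> (F x)" if "x \<in> Y" for x
    using that inj(1) by (simp add: f_def)
  have S: "openin (top_of_set ?V) S" "\<phi> m \<in> S" "S \<subseteq> ?V"
    using smooth_map_chart_domain_open[OF M L F Y(1) Z(1)] Y(2) Z(2) openin_imp_subset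
    unfolding S_def by blast+
  have f: "smooth_on ?V S f"
    using smooth_map_in_charts[OF F Y(1) Z(1)] by (simp add: f_def S_def)
  have "\<psi> ` Z \<subseteq> ?W"
    using chart_image_open[OF L Z(1)] by (rule openin_imp_subset)
  then have fW: "f ` S \<subseteq> ?W"
    using f_chart by (auto simp: S_def)
  obtain f' where "\<And>x. x \<in> S \<Longrightarrow> (f has_derivative f' x) (at x within S)"
    by (rule smooth_on_derivative[OF V S(1) f]) (rule that)
  then obtain D where D: "(f has_derivative D) (at (\<phi> m) within S)"
    using S(2) by blast
  then have "D ` ?V = ?W"
    using derivative_image_of_submersion[OF M L F surj Y Z] unfolding f_def S_def by blast
  then obtain A where A: "linear A" "range A \<subseteq> K" "inj_on (\<lambda>v. (A v, D v)) ?V"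
      "(\<lambda>v. (A v, D v)) ` ?V = K \<times> ?W"
    using linear_complement_of_surjection[OF has_derivative_linear[OF D] V W _ K(1)] K(2)
    unfolding mdim_def by blast
  define G where "G = (\<lambda>y. (A y, f y))"
  have "smooth_on ?V S G"
    unfolding G_def by (rule smooth_on_Pair[OF smooth_on_linear[OF A(1)] f])
  moreover have "G ` S \<subseteq> K \<times> ?W"
    using A(2) fW by (auto simp: G_def)
  moreover have "(G has_derivative (\<lambda>v. (A v, D v))) (at (\<phi> m) within S)"
    unfolding G_def
    using A(1) D by (intro has_derivative_Pair linear_imp_has_derivative)
  ultimately obtain S' T g where S': "openin (top_of_set ?V) S'" "\<phi> m \<in> S'" "S' \<subseteq> S"
    and T: "openin (top_of_set (K \<times> ?W)) T" and Gg: "homeomorphism S' T G g"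
    and g: "smooth_on (K \<times> ?W) T g"
    by (rule smooth_local_inverse[OF V subspace_Times[OF K(1) W] S(1,2) _ _ _ A(3,4)]) (rule that)
  have gG: "\<And>y. y \<in> S' \<Longrightarrow> G y \<in> T \<and> g (G y) = y" and Gg': "\<And>z. z \<in> T \<Longrightarrow> g z \<in> S' \<and> G (g z) = z"
    using Gg by (auto simp: homeomorphism_def)
  have "openin (prod_topology (top_of_set K) (top_of_set ?W)) T"
    using T by simp
  moreover have "(A (\<phi> m), f (\<phi> m)) \<in> T"
    using gG[OF S'(2)] by (simp add: G_def)
  ultimately obtain Q1 Q2 where Q: "openin (top_of_set K) Q1" "openin (top_of_set ?W) Q2"
      "A (\<phi> m) \<in> Q1" "f (\<phi> m) \<in> Q2" "Q1 \<times> Q2 \<subseteq> T"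
    unfolding openin_prod_topology_alt by meson
  have QK: "Q1 \<subseteq> K" "Q2 \<subseteq> ?W"
    using Q(1,2) openin_imp_subset by blast+
  define R where "R = S' \<inter> G -` (Q1 \<times> Q2)"
  have "openin (top_of_set S') R"
    unfolding R_def
  proof (rule continuous_openin_preimage)
    show "continuous_on S' G" "G \<in> S' \<rightarrow> T"
      using Gg by (auto simp: homeomorphism_def)
    have "openin (top_of_set (K \<times> ?W)) (Q1 \<times> Q2)"
      using Q(1,2) by (rule openin_Times)
    then show "openin (top_of_set T) (Q1 \<times> Q2)"
      using Q(5) openin_imp_subset[OF T] by (rule openin_subset_trans)
  qed
  then have R: "openin (top_of_set ?V) R" "R \<subseteq> \<phi> ` Y" "R \<subseteq> S'"
    using openin_trans S'(1,3) by (auto simp: R_def S_def)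
  define U where "U = {x \<in> Y. \<phi> x \<in> R}"
  define B where "B = {b \<in> Z. \<psi> b \<in> Q2}"
  define \<pi> where "\<pi> x = A (\<phi> x)" for x
  define \<Sigma> where "\<Sigma> = (\<lambda>(a, b). inv_into Y \<phi> (g (a, \<psi> b)))"
  have U: "openin (topo M) U"
    unfolding U_def by (rule chart_preimage_open[OF M Y(1) R(1,2)])
  have "m \<in> U"
    using Y(2) S'(2) Q(3,4) by (auto simp: U_def R_def G_def)
  have U_image: "F x \<in> B" "\<pi> x \<in> Q1" "\<Sigma> (\<pi> x, F x) = x" if "x \<in> U" for x
  proof -
    have x: "x \<in> Y" "\<phi> x \<in> S'" "G (\<phi> x) \<in> Q1 \<times> Q2"
      using that by (auto simp: U_def R_def)
    then obtain x' where "x' \<in> Y" "F x' \<in> Z" "\<phi> x = \<phi> x'"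
      using S'(3) by (auto simp: S_def)
    then have "F x \<in> Z"
      using inj(1) x(1) by (metis inj_onD)
    moreover have Gx: "G (\<phi> x) = (\<pi> x, \<psi> (F x))"
      using f_chart[OF x(1)] by (simp add: G_def \<pi>_def)
    ultimately show "F x \<in> B" "\<pi> x \<in> Q1"
      using x(3) by (auto simp: B_def)
    have "g (\<pi> x, \<psi> (F x)) = \<phi> x"
      using gG[OF x(2)] Gx by simp
    then show "\<Sigma> (\<pi> x, F x) = x"
      using inj(1) x(1) by (simp add: \<Sigma>_def)
  qed
  have \<Sigma>_image: "\<Sigma> (a, b) \<in> U \<and> \<pi> (\<Sigma> (a, b)) = a \<and> F (\<Sigma> (a, b)) = b" if ab: "a \<in> Q1" "b \<in> B" for a b
  proof -
    define y where "y = g (a, \<psi> b)"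
    have "(a, \<psi> b) \<in> Q1 \<times> Q2"
      using ab by (simp add: B_def)
    then have y: "y \<in> S'" "G y = (a, \<psi> b)" "y \<in> R"
      using Gg'[of "(a, \<psi> b)"] Q(5) by (auto simp: y_def R_def)
    then obtain x where x: "x \<in> Y" "F x \<in> Z" "y = \<phi> x"
      using S'(3) by (auto simp: S_def)
    have "\<Sigma> (a, b) = x"
      using x inj(1) by (simp add: \<Sigma>_def y_def[symmetric])
    moreover have "\<pi> x = a" "\<psi> (F x) = \<psi> b"
      using y(2) x f_chart[OF x(1)] by (auto simp: G_def \<pi>_def)
    moreover have "F x = b"
      using \<open>\<psi> (F x) = \<psi> b\<close> x(2) ab(2) inj(2) by (auto simp: B_def dest: inj_onD)
    moreover have "x \<in> U"
      using x y(3) by (simp add: U_def)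
    ultimately show ?thesis
      by simp
  qed
  have im\<pi>: "\<pi> ` U = Q1"
    using U_image(2) \<Sigma>_image[OF _ U_image(1)[OF \<open>m \<in> U\<close>]] by (metis image_subsetI image_eqI subsetI subset_antisym)
  have imF: "F ` U = B"
    using U_image(1) \<Sigma>_image[OF U_image(2)[OF \<open>m \<in> U\<close>]] by (metis image_subsetI image_eqI subsetI subset_antisym)
  \<comment> \<open>each point of \<open>T\<close> is \<open>G y\<close> for some \<open>y\<close> in \<open>S\<close>, where the values of \<open>f\<close> are chart values of points of \<open>Z\<close>\<close>
  have "Q2 \<subseteq> \<psi> ` Z"
  proof
    fix c assume c: "c \<in> Q2"
    then have "(A (\<phi> m), c) \<in> T"
      using Q(3,5) by blast
    then have y: "g (A (\<phi> m), c) \<in> S" "f (g (A (\<phi> m), c)) = c"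
      using Gg' S'(3) by (auto simp: G_def)
    then show "c \<in> \<psi> ` Z"
      using f_chart by (auto simp: S_def)
  qed
  note \<psi> = chart_preimage_open[OF L Z(1) Q(2) this, folded B_def]
    smooth_map_chart_restrict[OF L Z(1) Q(2) this, folded B_def]
  note \<phi> = smooth_map_chart_restrict[OF M Y(1) R(1,2), folded U_def]
    smooth_map_chart_inverse_restrict[OF M Y(1) R(1,2), folded U_def]
  let ?EV = "open_submanifold (euclidean_manifold ?V) R"
  let ?EW = "open_submanifold (euclidean_manifold ?W) Q2"
  let ?N = "open_submanifold (euclidean_manifold K) Q1"
  let ?EKW = "open_submanifold (euclidean_manifold (K \<times> ?W)) (Q1 \<times> Q2)"
  let ?MU = "open_submanifold M U" and ?LB = "open_submanifold L B"
  have smooth: "smooth_manifold ?EV" "smooth_manifold ?EW" "smooth_manifold ?N" "smooth_manifold ?EKW"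
    using V W K(1) R(1) Q(1,2)
    by (auto intro!: smooth_manifold_open_submanifold smooth_manifold_euclidean subspace_Times openin_Times)
  have MU: "smooth_manifold ?MU" and LB: "smooth_manifold ?LB"
    using smooth_manifold_open_submanifold M U L \<psi>(1) by blast+
  note P = smooth_manifold_product[OF smooth(3) LB]
  have "smooth_map ?EV ?N A"
  proof (rule smooth_map_between_euclidean[OF smooth_on_linear[OF A(1)]])
    show "A ` R \<subseteq> Q1"
      by (auto simp: R_def G_def)
    show "R \<subseteq> ?V" "Q1 \<subseteq> K"
      using R(1) QK openin_imp_subset by blast+
  qed
  then have "smooth_map ?MU ?N \<pi>"
    unfolding \<pi>_def by (rule smooth_map_compose[OF MU smooth(1,3) \<phi>(1)])
  moreover have "smooth_map ?MU ?LB F"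
    using smooth_map_open_submanifold[OF M F U \<psi>(1)] imF by blast
  ultimately have fwd: "smooth_map ?MU (product_manifold ?N ?LB) (\<lambda>x. (\<pi> x, F x))"
    by (rule smooth_map_Pair[OF MU smooth(3) LB])
  have "smooth_map (product_manifold ?N ?LB) ?EW (\<lambda>z. \<psi> (snd z))"
    by (rule smooth_map_compose[OF P LB smooth(2) smooth_map_snd[OF smooth(3) LB] \<psi>(2)])
  from smooth_map_Pair[OF P smooth(3,2) smooth_map_fst[OF smooth(3) LB] this]
  have 1: "smooth_map (product_manifold ?N ?LB) ?EKW (\<lambda>z. (fst z, \<psi> (snd z)))"
    unfolding product_open_euclidean .
  have "smooth_map ?EKW ?EV g"
  proof (rule smooth_map_between_euclidean[OF smooth_on_subset[OF g Q(5)]])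
    show "g ` (Q1 \<times> Q2) \<subseteq> R"
      using Gg' Q(5) by (auto simp: R_def)
    show "Q1 \<times> Q2 \<subseteq> K \<times> ?W"
      using QK by blast
    show "R \<subseteq> ?V"
      using R(1) by (rule openin_imp_subset)
  qed
  from smooth_map_compose[OF smooth(4,1) MU this \<phi>(2)]
  have "smooth_map ?EKW ?MU (\<lambda>z. inv_into Y \<phi> (g z))" .
  from smooth_map_compose[OF P smooth(4) MU 1 this]
  have bwd: "smooth_map (product_manifold ?N ?LB) ?MU \<Sigma>"
    by (simp add: \<Sigma>_def case_prod_unfold)
  have "pts ?MU = U" "pts ?N = Q1" "pts ?LB = B"
    using Q(1) by (simp_all only: pts_open_submanifold U \<psi>(1) euclidean_manifold_simps)
  then have "diffeomorphism ?MU (product_manifold ?N ?LB) (\<lambda>x. (\<pi> x, F x))"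
    by (intro diffeomorphismI[OF MU P fwd bwd]) (use U_image(3) \<Sigma>_image in auto)
  then show thesis
    using that[of U \<pi>] U \<open>m \<in> U\<close> im\<pi> imF Q(1) \<psi>(1) by simp
qed

section \<open>Complete solutions from product charts\<close>

text \<open>
In a product chart, a second component of velocity zero contributes to the velocity as a constant would; hence it may
be replaced by its value at \<open>0\<close>.
\<close>

lemma tangent_class_drop_stationary_component:
  assumes N: "smooth_manifold N" and L: "smooth_manifold L" and M: "smooth_manifold M"
    and \<Sigma>: "smooth_map (product_manifold N L) M \<Sigma>"
    and \<alpha>: "curve_at (product_manifold N L) (a, b) (\<lambda>t. (\<alpha> t, b))"
    and \<beta>: "curve_at (product_manifold N L) (a, b) (\<lambda>t. (\<alpha> t, \<beta> t))"
    and zero: "tangent_class L \<beta> = zero_tangent L b"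
  shows "tangent_class M (\<lambda>t. \<Sigma> (\<alpha> t, b)) = tangent_class M (\<lambda>t. \<Sigma> (\<alpha> t, \<beta> t))"
proof -
  let ?P = "product_manifold N L"
  note P = smooth_manifold_product[OF N L]
  have "a \<in> pts N" "b \<in> pts L"
    using curve_at_in[OF \<alpha>] by auto
  obtain W \<phi> where W: "(W, \<phi>) \<in> charts N" "a \<in> W"
    by (rule chart_exists[OF N \<open>a \<in> pts N\<close>])
  obtain W' \<psi> where W': "(W', \<psi>) \<in> charts L" "b \<in> W'"
    by (rule chart_exists[OF L \<open>b \<in> pts L\<close>])
  have chart: "(W \<times> W', map_prod \<phi> \<psi>) \<in> charts ?P" "(a, b) \<in> W \<times> W'"
    using W W' by (auto simp: charts_product_manifold)
  have "curve_at N a \<alpha>"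
    using curve_at_compose[OF P N smooth_map_fst[OF N L] \<beta>] by (simp add: o_def)
  note vN = curve_at_velocity(1)[OF N this W]
  have cL: "curve_at L b \<beta>"
    using curve_at_compose[OF P L smooth_map_snd[OF N L] \<beta>] by (simp add: o_def)
  note vL = curve_at_velocity(1)[OF L cL W']
  have "\<beta> \<in> tangent_class L (\<lambda>_. b)"
    using tangent_class_self[OF cL] zero by (simp add: zero_tangent_def)
  then have "vector_derivative (\<psi> \<circ> \<beta>) (at 0) = vector_derivative (\<psi> \<circ> (\<lambda>_. b)) (at 0)"
    using W' by (rule tangent_class_memD(2))
  also have "\<dots> = 0"
    by (simp add: o_def)
  finally have v0: "vector_derivative (\<psi> \<circ> \<beta>) (at 0) = 0" .
  have "((map_prod \<phi> \<psi> \<circ> (\<lambda>t. (\<alpha> t, b))) has_vector_derivative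
      (vector_derivative (\<phi> \<circ> \<alpha>) (at 0), 0)) (at 0)"
    using has_vector_derivative_Pair[OF vN has_vector_derivative_const] by (simp add: o_def)
  moreover have "((map_prod \<phi> \<psi> \<circ> (\<lambda>t. (\<alpha> t, \<beta> t))) has_vector_derivative
      (vector_derivative (\<phi> \<circ> \<alpha>) (at 0), 0)) (at 0)"
    using has_vector_derivative_Pair[OF vN vL] unfolding v0 by (simp add: o_def)
  ultimately have "vector_derivative (map_prod \<phi> \<psi> \<circ> (\<lambda>t. (\<alpha> t, b))) (at 0) =
      vector_derivative (map_prod \<phi> \<psi> \<circ> (\<lambda>t. (\<alpha> t, \<beta> t))) (at 0)"
    by (simp add: vector_derivative_at)
  from tangent_class_compose[OF P M \<Sigma> \<alpha> \<beta> chart this] show ?thesis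
    by (simp add: o_def)
qed

text \<open>
If \<open>\<gamma>\<close> represents \<open>X(p)\<close>, then \<open>\<Sigma>(\<pi> \<circ> \<gamma>, F \<circ> \<gamma>)\<close> is \<open>\<gamma>\<close>, whereas \<open>\<Sigma>(\<pi> \<circ> \<gamma>, l)\<close> represents the image of \<open>X(p)\<close>
under \<open>\<pi>\<close> followed by the section. Since \<open>F \<circ> \<gamma>\<close> has velocity zero, both represent the same vector.
\<close>

lemma HJE_solution_of_product:
  assumes M: "smooth_manifold M" and N: "smooth_manifold N" and L: "smooth_manifold L"
    and \<pi>: "smooth_map M N \<pi>" and F: "smooth_map M L F" and \<Sigma>: "smooth_map (product_manifold N L) M \<Sigma>"
    and inv: "\<And>p. p \<in> pts M \<Longrightarrow> \<Sigma> (\<pi> p, F p) = p"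
      "\<And>a b. a \<in> pts N \<Longrightarrow> b \<in> pts L \<Longrightarrow> \<pi> (\<Sigma> (a, b)) = a \<and> F (\<Sigma> (a, b)) = b"
    and X: "\<And>p. p \<in> pts M \<Longrightarrow> X p \<in> tangent_space M p"
      "\<And>p. p \<in> pts M \<Longrightarrow> tangent_map L F (X p) = zero_tangent L (F p)"
    and l: "l \<in> pts L"
  shows "HJE_solution M X N \<pi> (\<lambda>a. \<Sigma> (a, l))"
  unfolding HJE_solution_def smooth_section_def
proof (intro conjI ballI)
  let ?P = "product_manifold N L"
  note P = smooth_manifold_product[OF N L]
  show \<sigma>: "smooth_map N M (\<lambda>a. \<Sigma> (a, l))"
    by (rule smooth_map_compose[OF N P M smooth_map_Pair[OF N N L smooth_map_ident[OF N]
          smooth_map_const[OF l]] \<Sigma>])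
  show "\<pi> (\<Sigma> (a, l)) = a" if "a \<in> pts N" for a
    using inv(2) that l by blast
  fix a assume a: "a \<in> pts N"
  define p where "p = \<Sigma> (a, l)"
  have p: "p \<in> pts M" "\<pi> p = a" "F p = l"
    using smooth_map_in[OF \<Sigma>, of "(a, l)"] a l inv(2) by (simp_all add: p_def)
  obtain \<gamma> where \<gamma>: "curve_at M p \<gamma>" "X p = tangent_class M \<gamma>"
    using X(1)[OF p(1)] unfolding tangent_space_def by blast
  have c\<pi>: "curve_at N a (\<pi> \<circ> \<gamma>)"
    using curve_at_compose[OF M N \<pi> \<gamma>(1)] p(2) by simp
  have "curve_at ?P (\<pi> p, l) ((\<lambda>x. (\<pi> x, l)) \<circ> \<gamma>)"
    by (rule curve_at_compose[OF M P smooth_map_Pair[OF M N L \<pi> smooth_map_const[OF l]] \<gamma>(1)])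
  moreover have "curve_at ?P (\<pi> p, F p) ((\<lambda>x. (\<pi> x, F x)) \<circ> \<gamma>)"
    by (rule curve_at_compose[OF M P smooth_map_Pair[OF M N L \<pi> F] \<gamma>(1)])
  moreover have "tangent_class L (F \<circ> \<gamma>) = zero_tangent L l"
    using X(2)[OF p(1)] tangent_map_class[OF M L F \<gamma>(1)] \<gamma>(2) p(3) by simp
  ultimately have eq: "tangent_class M (\<lambda>t. \<Sigma> (\<pi> (\<gamma> t), l)) = tangent_class M (\<lambda>t. \<Sigma> (\<pi> (\<gamma> t), F (\<gamma> t)))"
    using tangent_class_drop_stationary_component[OF N L M \<Sigma>, of a l "\<lambda>t. \<pi> (\<gamma> t)" "\<lambda>t. F (\<gamma> t)"] p by (simp add: o_def)
  obtain I where I: "open I" "0 \<in> I" "\<And>t. t \<in> I \<Longrightarrow> \<gamma> t \<in> pts M"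
    by (rule curve_at_eventually[OF \<gamma>(1) openin_topspace p(1)]) (rule that)
  have "\<forall>\<^sub>F t in nhds 0. \<Sigma> (\<pi> (\<gamma> t), F (\<gamma> t)) = \<gamma> t"
    unfolding eventually_nhds using I inv(1) by (intro exI[of _ I]) simp
  then have "tangent_class M (\<lambda>t. \<Sigma> (\<pi> (\<gamma> t), F (\<gamma> t))) = X p"
    unfolding \<gamma>(2) by (rule tangent_class_germ)
  then have "tangent_class M ((\<lambda>a. \<Sigma> (a, l)) \<circ> (\<pi> \<circ> \<gamma>)) = X p"
    using eq by (simp add: o_def)
  then have "tangent_map M (\<lambda>a. \<Sigma> (a, l)) (tangent_map N \<pi> (X p)) = X p"
    unfolding \<gamma>(2) tangent_map_class[OF M N \<pi> \<gamma>(1)] tangent_map_class[OF N M \<sigma> c\<pi>] .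
  then show "tangent_map M (\<lambda>a. \<Sigma> (a, l)) (tangent_map N \<pi> (X (\<Sigma> (a, l)))) = X (\<Sigma> (a, l))"
    by (simp add: p_def)
qed

text \<open>
A section through \<open>p\<close> is a right inverse of \<open>\<pi>\<close>, so its tangent map is a right inverse of \<open>\<pi>\<^sub>*\<close> on the tangent
space at \<open>p\<close>.
\<close>

lemma fibration_if_sections:
  assumes M: "smooth_manifold M" and N: "smooth_manifold N" and \<pi>: "smooth_map M N \<pi>" "\<pi> ` pts M = pts N"
    and sections: "\<And>p. p \<in> pts M \<Longrightarrow> \<exists>\<sigma>. smooth_section M N \<pi> \<sigma> \<and> \<sigma> (\<pi> p) = p"
  shows "fibration M N \<pi>"
  unfolding fibration_def
proof (intro conjI M N \<pi> ballI equalityI subsetI)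
  fix p w assume p: "p \<in> pts M" and "w \<in> tangent_map N \<pi> ` tangent_space M p"
  then obtain \<gamma> where "curve_at M p \<gamma>" "w = tangent_map N \<pi> (tangent_class M \<gamma>)"
    unfolding tangent_space_def by blast
  then show "w \<in> tangent_space N (\<pi> p)"
    using tangent_map_class[OF M N \<pi>(1)] curve_at_compose[OF M N \<pi>(1)] unfolding tangent_space_def by blast
next
  fix p w assume p: "p \<in> pts M" and "w \<in> tangent_space N (\<pi> p)"
  then obtain \<beta> where \<beta>: "curve_at N (\<pi> p) \<beta>" "w = tangent_class N \<beta>"
    unfolding tangent_space_def by blast
  obtain \<sigma> where "smooth_section M N \<pi> \<sigma>" and "\<sigma> (\<pi> p) = p"
    using sections[OF p] by blast
  then have \<sigma>: "smooth_map N M \<sigma>" "\<And>x. x \<in> pts N \<Longrightarrow> \<pi> (\<sigma> x) = x" "\<sigma> (\<pi> p) = p"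
    by (simp_all add: smooth_section_def)
  have c: "curve_at M p (\<sigma> \<circ> \<beta>)"
    using curve_at_compose[OF N M \<sigma>(1) \<beta>(1)] \<sigma>(3) by simp
  obtain I where I: "open I" "0 \<in> I" "\<And>t. t \<in> I \<Longrightarrow> \<beta> t \<in> pts N"
    by (rule curve_at_eventually[OF \<beta>(1) openin_topspace curve_at_in[OF \<beta>(1)]]) (rule that)
  have "\<forall>\<^sub>F t in nhds 0. (\<pi> \<circ> (\<sigma> \<circ> \<beta>)) t = \<beta> t"
    unfolding eventually_nhds using I \<sigma>(2) by (intro exI[of _ I]) simp
  then have "tangent_class N (\<pi> \<circ> (\<sigma> \<circ> \<beta>)) = w"
    unfolding \<beta>(2) by (rule tangent_class_germ)
  then have "w = tangent_map N \<pi> (tangent_class M (\<sigma> \<circ> \<beta>))"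
    using tangent_map_class[OF M N \<pi>(1) c] by simp
  then show "w \<in> tangent_map N \<pi> ` tangent_space M p"
    using c unfolding tangent_space_def by blast
qed

lemma
  assumes M: "smooth_manifold M" and N: "smooth_manifold N" and L: "smooth_manifold L"
    and dims: "mdim L + mdim N = mdim M"
    and diffeo: "diffeomorphism M (product_manifold N L) (\<lambda>x. (\<pi> x, F x))"
    and surj: "\<pi> ` pts M = pts N"
    and X: "vector_field M X" "\<And>p. p \<in> pts M \<Longrightarrow> tangent_map L F (X p) = zero_tangent L (F p)"
  shows fibration_of_product: "fibration M N \<pi>"
    and complete_solution_of_product:
      "complete_solution M X N \<pi> L (inv_into (pts M) (\<lambda>x. (\<pi> x, F x)))"
    and global_momentum_map_of_product:
      "global_momentum_map M N L (inv_into (pts M) (\<lambda>x. (\<pi> x, F x))) F"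
proof -
  let ?P = "product_manifold N L" and ?G = "\<lambda>x. (\<pi> x, F x)"
  define \<Sigma> where "\<Sigma> = inv_into (pts M) ?G"
  note P = smooth_manifold_product[OF N L]
  have G: "smooth_map M ?P ?G" and \<Sigma>: "smooth_map ?P M \<Sigma>" and bij: "bij_betw ?G (pts M) (pts N \<times> pts L)"
    using diffeo by (simp_all add: diffeomorphism_def \<Sigma>_def)
  have \<pi>: "smooth_map M N \<pi>" and F: "smooth_map M L F"
    using smooth_map_compose[OF M P N G smooth_map_fst[OF N L]]
      smooth_map_compose[OF M P L G smooth_map_snd[OF N L]] by simp_all
  have inv: "\<Sigma> (\<pi> p, F p) = p" if "p \<in> pts M" for p
    using bij_betw_inv_into_left[OF bij that] by (simp add: \<Sigma>_def)
  have inv': "\<pi> (\<Sigma> (a, b)) = a \<and> F (\<Sigma> (a, b)) = b" if "a \<in> pts N" "b \<in> pts L" for a b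
    using bij_betw_inv_into_right[OF bij, of "(a, b)"] that by (simp add: \<Sigma>_def)
  have solution: "HJE_solution M X N \<pi> (\<lambda>a. \<Sigma> (a, l))" if "l \<in> pts L" for l
    using X that by (intro HJE_solution_of_product[OF M N L \<pi> F \<Sigma>] inv inv') (auto simp: vector_field_def)
  show fib: "fibration M N \<pi>"
  proof (rule fibration_if_sections[OF M N \<pi> surj])
    fix p assume p: "p \<in> pts M"
    have "smooth_section M N \<pi> (\<lambda>a. \<Sigma> (a, F p))"
      using solution[OF smooth_map_in[OF F p]] by (simp add: HJE_solution_def)
    then show "\<exists>\<sigma>. smooth_section M N \<pi> \<sigma> \<and> \<sigma> (\<pi> p) = p"
      using inv[OF p] by blast
  qed
  have diffeo\<Sigma>: "diffeomorphism ?P M \<Sigma>"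
    unfolding \<Sigma>_def by (rule diffeomorphism_inverse[OF M P diffeo])
  then have bij\<Sigma>: "bij_betw \<Sigma> (pts N \<times> pts L) (pts M)"
    by (simp add: diffeomorphism_def)
  have "complete_solution M X N \<pi> L \<Sigma>"
    unfolding complete_solution_def dynamical_system_def
    using M L X(1) fib dims solution diffeomorphism_imp_local_diffeomorphism[OF P M diffeo\<Sigma>]
      bij_betw_imp_surj_on[OF bij\<Sigma>] by simp
  then show "complete_solution M X N \<pi> L (inv_into (pts M) ?G)"
    by (simp only: \<Sigma>_def)
  have "F p = (snd \<circ> inv_into (pts N \<times> pts L) \<Sigma>) p" if p: "p \<in> pts M" for p
  proof -
    have "inv_into (pts N \<times> pts L) \<Sigma> p = (\<pi> p, F p)"
      using bij_betw_inv_into_left[OF bij\<Sigma>, of "(\<pi> p, F p)"] inv[OF p] smooth_map_in[OF \<pi> p]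
        smooth_map_in[OF F p] by simp
    then show ?thesis
      by simp
  qed
  then have "global_momentum_map M N L \<Sigma> F"
    unfolding global_momentum_map_def using diffeo\<Sigma> by simp
  then show "global_momentum_map M N L (inv_into (pts M) ?G) F"
    by (simp only: \<Sigma>_def)
qed

text \<open>
Membership in \<open>tangent_kernel\<close> mentions some base point; it must be \<open>p\<close>, since every curve in \<open>X p\<close> passes through
\<open>p\<close> at parameter \<open>0\<close>.
\<close>

lemma vanishing_pushforward_open_submanifold:
  assumes M: "smooth_manifold M" and L: "smooth_manifold L" and F: "smooth_map M L F"
    and X: "X ` pts M \<subseteq> tangent_kernel M L F" "X p \<in> tangent_space M p"
    and B: "openin (topo L) B" "F p \<in> B" and p: "p \<in> pts M"
  shows "tangent_map (open_submanifold L B) F (X p) = zero_tangent (open_submanifold L B) (F p)"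
proof -
  obtain \<gamma> where \<gamma>: "curve_at M p \<gamma>" "X p = tangent_class M \<gamma>"
    using X(2) unfolding tangent_space_def by blast
  have base: "\<delta> 0 = p" if "\<delta> \<in> X p" for \<delta>
    using that \<gamma> by (auto simp: tangent_class_def curve_at_def)
  \<comment> \<open>\<open>q\<close> is the base point provided by the definition of the kernel\<close>
  obtain q where q: "X p \<in> tangent_space M q" "tangent_map L F (X p) = zero_tangent L (F q)"
    using X(1) p by (auto simp: tangent_kernel_def)
  then obtain \<delta> where \<delta>: "curve_at M q \<delta>" "X p = tangent_class M \<delta>"
    unfolding tangent_space_def by blast
  have "\<delta> \<in> X p"
    using tangent_class_self[OF \<delta>(1)] \<delta>(2) by simp
  then have "q = p"
    using base[OF \<open>\<delta> \<in> X p\<close>] \<delta>(1) by (simp add: curve_at_def)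
  have "tangent_class (open_submanifold L B) (F \<circ> \<delta>) = tangent_class L (F \<circ> \<delta>)" if "\<delta> \<in> X p" for \<delta>
    using tangent_class_open_submanifold[OF L B(1)] base[OF that] B(2) by simp
  then have "tangent_map (open_submanifold L B) F (X p) = tangent_map L F (X p)"
    by (simp add: tangent_map_def)
  also have "\<dots> = zero_tangent L (F p)"
    using q(2) \<open>q = p\<close> by simp
  also have "\<dots> = zero_tangent (open_submanifold L B) (F p)"
    unfolding zero_tangent_def using tangent_class_open_submanifold[OF L B(1)] B(2) by simp
  finally show ?thesis .
qed

section \<open>Local complete solutions\<close>

theorem theorem4p11:
  fixes M :: "('a, 'e::euclidean_space) manifold"
    and X :: "'a \<Rightarrow> (real \<Rightarrow> 'a) set"
    and L :: "('b, 'g::euclidean_space) manifold"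
    and F :: "'a \<Rightarrow> 'b"
    and K :: "'k::euclidean_space set"
    and d l :: nat
  assumes "dynamical_system M X"
    and "mdim M = d"
    and "smooth_manifold L"
    and "mdim L = l"
    and "l \<le> d"
    and "fibration M L F"
    and "X ` pts M \<subseteq> tangent_kernel M L F"
    and "subspace K"
    and "dim K = d - l"
  shows "\<forall>m\<in>pts M. \<exists>U (\<pi> :: 'a \<Rightarrow> 'k).
     openin (topo M) U \<and> m \<in> U \<and>
     openin (top_of_set K) (\<pi> ` U) \<and> openin (topo L) (F ` U) \<and>
     (let MU = open_submanifold M U;
          N = open_submanifold (euclidean_manifold K) (\<pi> ` U);
          LU = open_submanifold L (F ` U);
          \<Sigma> = inv_into U (\<lambda>x. (\<pi> x, F x))
      in fibration MU N \<pi> \<and>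
         diffeomorphism MU (product_manifold N LU) (\<lambda>x. (\<pi> x, F x)) \<and>
         complete_solution MU X N \<pi> LU \<Sigma> \<and>
         global_momentum_map MU N LU \<Sigma> F)"
proof
  fix m assume m: "m \<in> pts M"
  have M: "smooth_manifold M" and X: "vector_field M X" and F: "smooth_map M L F"
    and surj: "tangent_map L F ` tangent_space M m = tangent_space L (F m)"
    using assms(1,6) m by (simp_all add: dynamical_system_def fibration_def)
  have "dim K + mdim L = mdim M"
    using assms(2,4,5,9) by simp
  then obtain U and \<pi> :: "'a \<Rightarrow> 'k" where U: "openin (topo M) U" "m \<in> U"
    and open\<pi>: "openin (top_of_set K) (\<pi> ` U)" and openF: "openin (topo L) (F ` U)"
    and diffeo: "diffeomorphism (open_submanifold M U)
      (product_manifold (open_submanifold (euclidean_manifold K) (\<pi> ` U)) (open_submanifold L (F ` U)))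
      (\<lambda>x. (\<pi> x, F x))"
    by (rule submersion_local_trivialisation[OF M assms(3) F m surj assms(8)]) (rule that)
  let ?MU = "open_submanifold M U" and ?LU = "open_submanifold L (F ` U)"
  let ?N = "open_submanifold (euclidean_manifold K) (\<pi> ` U)"
  have MU: "smooth_manifold ?MU" and LU: "smooth_manifold ?LU" and N: "smooth_manifold ?N"
    using M U(1) assms(3,8) openF open\<pi>
    by (simp_all add: smooth_manifold_open_submanifold smooth_manifold_euclidean)
  have pts: "pts ?MU = U"
    using U(1) by (rule pts_open_submanifold)
  have "pts ?N = \<pi> ` U"
    using open\<pi> by (simp only: pts_open_submanifold euclidean_manifold_simps)
  then have surj\<pi>: "\<pi> ` pts ?MU = pts ?N"
    by (simp only: pts)
  have dims: "mdim ?LU + mdim ?N = mdim ?MU"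
    using assms(2,4,5,9) by (simp add: mdim_def)
  have "tangent_map ?LU F (X p) = zero_tangent ?LU (F p)" if "p \<in> pts ?MU" for p
  proof (rule vanishing_pushforward_open_submanifold[OF M assms(3) F assms(7) _ openF])
    have "p \<in> U"
      using that pts by simp
    then show "F p \<in> F ` U" "p \<in> pts M"
      using openin_subset[OF U(1)] by auto
    then show "X p \<in> tangent_space M p"
      using X by (simp add: vector_field_def)
  qed
  note product = MU N LU dims diffeo surj\<pi> vector_field_open_submanifold[OF M X U(1)] this
  show "\<exists>U (\<pi> :: 'a \<Rightarrow> 'k).
     openin (topo M) U \<and> m \<in> U \<and>
     openin (top_of_set K) (\<pi> ` U) \<and> openin (topo L) (F ` U) \<and>
     (let MU = open_submanifold M U;
          N = open_submanifold (euclidean_manifold K) (\<pi> ` U);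
          LU = open_submanifold L (F ` U);
          \<Sigma> = inv_into U (\<lambda>x. (\<pi> x, F x))
      in fibration MU N \<pi> \<and>
         diffeomorphism MU (product_manifold N LU) (\<lambda>x. (\<pi> x, F x)) \<and>
         complete_solution MU X N \<pi> LU \<Sigma> \<and>
         global_momentum_map MU N LU \<Sigma> F)"
    unfolding Let_def
    using U open\<pi> openF diffeo fibration_of_product[OF product]
      complete_solution_of_product[OF product, unfolded pts]
      global_momentum_map_of_product[OF product, unfolded pts]
    by blast
qed

end
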